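(* Let $k\subset\mathbb{C}$ be a number field stable under complex conjugation, with ring of integers $\mathbb{Z}_k$, and let $(V,W)$ be a pair of finite dimensional $k$-vector spaces with a Hermitian pairing. (1) Let $\mathfrak{R}$ be a $\mathbb{Z}_k$-root system in $V$. Then $(V,G(\mathfrak{R}))$ is an essential finite reflection group; that is, $G(\mathfrak{R})$ is finite and $V^{G(\mathfrak{R})}=0$. (2) Let $(V,G)$ be an essential finite reflection group over $k$ (that is, $G$ is a finite subgroup of $\mathrm{GL}(V)$ generated by reflections and $V^G=0$). Then there exists a $\mathbb{Z}_k$-root system $\mathfrak{R}$ in $V$ such that $G(\mathfrak{R})=G$.
   Context: Write $\lambda\mapsto\lambda^*$ for complex conjugation. A Hermitian pairing $V\times W\to k$, $(v,w)\mapsto\langle v,w\rangle$, is linear in $V$, semi-linear in $W$ ($\langle\lambda v,\mu w\rangle=\lambda\mu^*\langle v,w\rangle$) and non-degenerate on both sides. For $g\in\mathrm{GL}(V)$, $g^\vee\in\mathrm{GL}(W)$ is the unique element with $\langle g v,g^\vee w\rangle=\langle v,w\rangle$ for all $v,w$. A reflection on $V$ is an element $s\in\mathrm{GL}(V)$ of finite order such that $\ker(s-1)$ is a hyperplane. For finitely generated $\mathbb{Z}_k$-submodules $I\subset V$, $J\subset W$, $\langle I,J\rangle$ is the fractional ideal generated by all $\langle\alpha,\beta\rangle$, $\alpha\in I,\beta\in J$. A $\mathbb{Z}_k$-root is a triple $\mathfrak{r}=(I,J,\zeta)$ where $I\subset V$ and $J\subset W$ are rank one finitely generated $\mathbb{Z}_k$-submodules,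 $\zeta\neq1$ is a root of unity in $k$, and $\langle I,J\rangle=(1-\zeta)\mathbb{Z}_k$. Its reflection is $s_{\mathfrak r}(x)=x-\langle x,w\rangle v$ for any $v\in kI$, $w\in kJ$ with $\langle v,w\rangle=1-\zeta$. $\mathrm{GL}(V)$ acts on roots by $g\cdot(I,J,\zeta)=(g(I),g^\vee(J),\zeta)$. A set $\mathfrak{R}=\{\mathfrak r=(I_{\mathfrak r},J_{\mathfrak r},\zeta_{\mathfrak r})\}$ of $\mathbb{Z}_k$-roots is a $\mathbb{Z}_k$-root system if: (RS$_I$) $\mathfrak{R}$ is finite and the family $(I_{\mathfrak r})_{\mathfrak{r}\in\mathfrak R}$ generates $V$; (RS$_{II}$) $s_{\mathfrak r}\cdot\mathfrak{R}=\mathfrak{R}$ for all $\mathfrak r\in\mathfrak R$; (RS$_{III}$) $\langle I_{\mathfrak r_1},J_{\mathfrak r_2}\rangle\subseteq\mathbb{Z}_k$ for all $\mathfrak r_1,\mathfrak r_2\in\mathfrak R$. $G(\mathfrak{R})$ denotes the subgroup of $\mathrm{GL}(V)$ generated by the $s_{\mathfrak r}$, $\mathfrak r\in\mathfrak R$. *)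

theory Defs
  imports Complex_Main
    "HOL-Computational_Algebra.Polynomial"
    "HOL-Algebra.Generated_Groups"
begin

text \<open>
  The number field \<open>k\<close> is a type \<open>'k\<close> together with a field embedding \<open>emb\<close> into the complex
  numbers; the subfield of the complex numbers is the range of \<open>emb\<close>. Its ring of integers is
  the set of those elements satisfying the library predicate \<^const>\<open>algebraic_int\<close>.
\<close>

locale conj_stable_number_field =
  fixes emb :: "'k::field_char_0 \<Rightarrow> complex"
  assumes emb_one: "emb 1 = 1"
    and emb_add: "emb (x + y) = emb x + emb y"
    and emb_mult: "emb (x * y) = emb x * emb y"
    and finite_degree:
      "\<exists>B::'k set. finite B \<and> module.span (\<lambda>(q::rat) x. of_rat q * x) B = UNIV"
    and cnj_stable: "cnj ` range emb \<subseteq> range emb"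
begin

text \<open>Complex conjugation, transported to \<open>'k\<close> along the (injective) embedding.\<close>

definition k_conj :: "'k \<Rightarrow> 'k"
  where "k_conj x = the_inv emb (cnj (emb x))"

end

definition Zk_submodule :: "('k::field \<Rightarrow> 'a::ab_group_add \<Rightarrow> 'a) \<Rightarrow> 'a set \<Rightarrow> bool"
  where "Zk_submodule scale I \<longleftrightarrow>
    0 \<in> I \<and> (\<forall>x\<in>I. \<forall>y\<in>I. x + y \<in> I) \<and> (\<forall>a. algebraic_int a \<longrightarrow> (\<forall>x\<in>I. scale a x \<in> I))"

definition Zk_span :: "('k::field \<Rightarrow> 'a::ab_group_add \<Rightarrow> 'a) \<Rightarrow> 'a set \<Rightarrow> 'a set"
  where "Zk_span scale S = Zk_submodule scale hull S"

definition Zk_finitely_generated :: "('k::field \<Rightarrow> 'a::ab_group_add \<Rightarrow> 'a) \<Rightarrow> 'a set \<Rightarrow> bool"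
  where "Zk_finitely_generated scale I \<longleftrightarrow> (\<exists>B. finite B \<and> I = Zk_span scale B)"

definition GL :: "('k::field \<Rightarrow> 'v::ab_group_add \<Rightarrow> 'v) \<Rightarrow> ('v \<Rightarrow> 'v) monoid"
  where "GL scale = \<lparr>carrier = {g. Vector_Spaces.linear scale scale g \<and> bij g},
                     monoid.mult = (\<circ>), one = id\<rparr>"

text \<open>
  The last conjunct says that \<open>ker (s - 1)\<close> is a hyperplane; the spaces below are
  finite-dimensional.
\<close>

definition is_reflection :: "('k::field \<Rightarrow> 'v::ab_group_add \<Rightarrow> 'v) \<Rightarrow> ('v \<Rightarrow> 'v) \<Rightarrow> bool"
  where "is_reflection scale s \<longleftrightarrow>
    s \<in> carrier (GL scale) \<and> (\<exists>n>0. s ^^ n = id) \<and>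
    vector_space.dim scale {x. s x = x} + 1 = vector_space.dim scale (UNIV :: 'v set)"

definition finite_reflection_group ::
    "('k::field \<Rightarrow> 'v::ab_group_add \<Rightarrow> 'v) \<Rightarrow> ('v \<Rightarrow> 'v) set \<Rightarrow> bool"
  where "finite_reflection_group scale G \<longleftrightarrow>
    subgroup G (GL scale) \<and> finite G \<and>
    (\<exists>S. (\<forall>s\<in>S. is_reflection scale s) \<and> G = generate (GL scale) S)"

definition fixed_space :: "('v \<Rightarrow> 'v) set \<Rightarrow> 'v set"
  where "fixed_space G = {x. \<forall>g\<in>G. g x = x}"

definition essential_finite_reflection_group ::
    "('k::field \<Rightarrow> 'v::ab_group_add \<Rightarrow> 'v) \<Rightarrow> ('v \<Rightarrow> 'v) set \<Rightarrow> bool"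
  where "essential_finite_reflection_group scale G \<longleftrightarrow>
    finite_reflection_group scale G \<and> fixed_space G = {0}"

text \<open>The \<open>k\<close>-vector spaces \<open>V\<close> and \<open>W\<close> are the full types \<open>'v\<close> and \<open>'w\<close>.\<close>

locale hermitian_pairing =
  conj_stable_number_field emb + V: vector_space scaleV + W: vector_space scaleW
  for emb :: "'k::field_char_0 \<Rightarrow> complex"
    and scaleV :: "'k \<Rightarrow> 'v::ab_group_add \<Rightarrow> 'v"
    and scaleW :: "'k \<Rightarrow> 'w::ab_group_add \<Rightarrow> 'w" +
  fixes pair :: "'v \<Rightarrow> 'w \<Rightarrow> 'k"
  assumes finite_dim_V: "\<exists>B. finite B \<and> V.span B = UNIV"
    and finite_dim_W: "\<exists>B. finite B \<and> W.span B = UNIV"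
    and pair_add_left: "pair (v + v') w = pair v w + pair v' w"
    and pair_scale_left: "pair (scaleV a v) w = a * pair v w"
    and pair_add_right: "pair v (w + w') = pair v w + pair v w'"
    and pair_scale_right: "pair v (scaleW a w) = k_conj a * pair v w"
    and nondegenerate_left: "(\<And>w. pair v w = 0) \<Longrightarrow> v = 0"
    and nondegenerate_right: "(\<And>v. pair v w = 0) \<Longrightarrow> w = 0"
begin

definition dual :: "('v \<Rightarrow> 'v) \<Rightarrow> 'w \<Rightarrow> 'w"
  where "dual g = (THE h. h \<in> carrier (GL scaleW) \<and> (\<forall>v w. pair (g v) (h w) = pair v w))"

definition pair_ideal :: "'v set \<Rightarrow> 'w set \<Rightarrow> 'k set"
  where "pair_ideal I J = Zk_span (*) {pair \<alpha> \<beta> | \<alpha> \<beta>. \<alpha> \<in> I \<and> \<beta> \<in> J}"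

text \<open>
  The rank of a \<open>\<int>\<^sub>k\<close>-submodule \<open>I\<close> is the \<open>k\<close>-dimension of its linear span
  \<open>kI\<close>, and \<^const>\<open>V.dim\<close> of a set is the dimension of its span.
\<close>

definition is_root :: "'v set \<times> 'w set \<times> 'k \<Rightarrow> bool"
  where "is_root = (\<lambda>(I, J, \<zeta>).
    Zk_finitely_generated scaleV I \<and> V.dim I = 1 \<and>
    Zk_finitely_generated scaleW J \<and> W.dim J = 1 \<and>
    \<zeta> \<noteq> 1 \<and> (\<exists>n>0. \<zeta> ^ n = 1) \<and>
    pair_ideal I J = {(1 - \<zeta>) * a | a. algebraic_int a})"

text \<open>
  For a root, admissible \<open>v\<close> and \<open>w\<close> exist and the resulting map does not depend on the choice.
\<close>

definition root_reflection :: "'v set \<times> 'w set \<times> 'k \<Rightarrow> 'v \<Rightarrow> 'v"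
  where "root_reflection = (\<lambda>(I, J, \<zeta>). THE s.
    \<exists>v\<in>V.span I. \<exists>w\<in>W.span J. pair v w = 1 - \<zeta> \<and> s = (\<lambda>x. x - scaleV (pair x w) v))"

definition root_action ::
    "('v \<Rightarrow> 'v) \<Rightarrow> 'v set \<times> 'w set \<times> 'k \<Rightarrow> 'v set \<times> 'w set \<times> 'k"
  where "root_action g = (\<lambda>(I, J, \<zeta>). (g ` I, dual g ` J, \<zeta>))"

definition root_system :: "('v set \<times> 'w set \<times> 'k) set \<Rightarrow> bool"
  where "root_system R \<longleftrightarrow>
    (\<forall>r\<in>R. is_root r) \<and>
    finite R \<and> V.span (\<Union>(I, J, \<zeta>)\<in>R. I) = UNIV \<and>
    (\<forall>r\<in>R. root_action (root_reflection r) ` R = R) \<and>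
    (\<forall>(I\<^sub>1, J\<^sub>1, \<zeta>\<^sub>1)\<in>R. \<forall>(I\<^sub>2, J\<^sub>2, \<zeta>\<^sub>2)\<in>R. pair_ideal I\<^sub>1 J\<^sub>2 \<subseteq> {a. algebraic_int a})"

definition root_group :: "('v set \<times> 'w set \<times> 'k) set \<Rightarrow> ('v \<Rightarrow> 'v) set"
  where "root_group R = generate (GL scaleV) (root_reflection ` R)"

end

end

theory Submission
  imports Defs "Jordan_Normal_Form.Char_Poly"
begin

text \<open>
  (1) The finite set \<open>T\<close> of root reflections is stable under conjugation by the group \<open>G\<close> it
  generates, so it suffices to bound the kernel of \<open>G\<close> acting on \<open>T\<close>, which is central and acts on
  every root line by a scalar. \<open>G\<close> acts monomially on the root lines of a conjugacy class \<open>C\<close>; the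
  product of the monomial coefficients is a homomorphism to the multiplicative group of \<open>k\<close> whose values
  are roots of unity, because the generators have finite order, and which sends a central element
  acting by \<open>c\<close> to \<open>c\<close> to the power \<open>|C|\<close>. Hence these scalars are roots of unity of bounded order.

  (2) Choose a \<open>G\<close>-stable full lattice \<open>Q\<close>. A reflection \<open>s\<close> with eigenvalue \<open>\<zeta>\<close> gets
  \<open>I = (1 - s) Q\<close>, and \<open>J\<close> consists of the vectors \<open>\<beta>\<close> on the dual line with
  \<open>\<langle>I, \<beta>\<rangle> \<subseteq> (1 - \<zeta>) \<int>\<^sub>k\<close>. For \<open>\<alpha> \<in> Q\<close> and \<open>\<beta> \<in> J\<close>,
  \<open>(1 - \<zeta>) \<langle>\<alpha>, \<beta>\<rangle> = \<langle>\<alpha> - s \<alpha>, \<beta>\<rangle>\<close> lies in \<open>(1 - \<zeta>) \<int>\<^sub>k\<close>,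
  which gives integrality. That \<open>\<langle>I, J\<rangle>\<close> is all of \<open>(1 - \<zeta>) \<int>\<^sub>k\<close> is the invertibility of
  fractional ideals, obtained from Dedekind's Prague theorem.
\<close>

subsection \<open>Algebraic integers\<close>

interpretation int_module: Modules.module "\<lambda>(n::int) (x::'a::field_char_0). of_int n * x"
  by standard (auto simp: algebra_simps)

abbreviation int_span :: "'a::field_char_0 set \<Rightarrow> 'a set"
  where "int_span \<equiv> Modules.module.span (\<lambda>(n::int) x. of_int n * x)"

lemma int_span_mult_right:
  fixes y z :: "'a::field_char_0"
  assumes "y \<in> int_span S"
  shows "y * z \<in> int_span ((\<lambda>s. s * z) ` S)"
  using assms
proof (induction rule: int_module.span_induct_alt)
  case base
  show ?case by (simp add: int_module.span_zero)
next
  case (step c x y)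
  have "of_int c * (x * z) + y * z \<in> int_span ((\<lambda>s. s * z) ` S)"
    by (intro int_module.span_add int_module.span_scale step int_module.span_base imageI)
  then show ?case by (simp add: algebra_simps)
qed

text \<open>Determinant trick: listing \<open>S\<close> as a vector exhibits \<open>x\<close> as an
  eigenvalue of an integer matrix, hence as a root of its monic integer characteristic polynomial.
  Since 1 is in \<open>S\<close>, the eigenvector is nonzero.\<close>

lemma algebraic_int_of_int_span:
  fixes x :: "'a::field_char_0"
  assumes fin: "finite S" and one: "1 \<in> S"
    and stable: "\<And>s. s \<in> S \<Longrightarrow> x * s \<in> int_span S"
  shows "algebraic_int x"
proof -
  obtain xs where xs: "set xs = S" "distinct xs"
    using finite_distinct_list[OF fin] by blast
  define n where "n = length xs"
  have "\<exists>u. x * s = (\<Sum>t\<in>S. of_int (u t) * t)" if "s \<in> S" for s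
    using stable[OF that] by (auto simp: int_module.span_finite[OF fin])
  then obtain u where u: "\<And>s. s \<in> S \<Longrightarrow> x * s = (\<Sum>t\<in>S. of_int (u s t) * t)"
    by metis
  define B where "B = mat n n (\<lambda>(i, j). u (xs ! i) (xs ! j))"
  define M where "M = map_mat (of_int :: int \<Rightarrow> 'a) B"
  define v where "v = vec n (\<lambda>i. xs ! i)"
  have B: "B \<in> carrier_mat n n" by (simp add: B_def)
  have M: "M \<in> carrier_mat n n" using B by (simp add: M_def)
  have "eigenvector M v x"
    unfolding eigenvector_def
  proof (intro conjI)
    show "v \<in> carrier_vec (dim_row M)" using M by (simp add: v_def)
    obtain i where "i < n" "xs ! i = 1"
      using one xs by (metis in_set_conv_nth n_def)
    then have "v $ i \<noteq> 0\<^sub>v n $ i" by (simp add: v_def)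
    then show "v \<noteq> 0\<^sub>v (dim_row M)" using M by auto
    show "M *\<^sub>v v = x \<cdot>\<^sub>v v"
    proof (rule eq_vecI)
      show "dim_vec (M *\<^sub>v v) = dim_vec (x \<cdot>\<^sub>v v)" using M by (simp add: v_def)
      fix i assume "i < dim_vec (x \<cdot>\<^sub>v v)"
      then have i: "i < n" by (simp add: v_def)
      have "(M *\<^sub>v v) $ i = (\<Sum>j<n. of_int (u (xs ! i) (xs ! j)) * xs ! j)"
        using i by (simp add: M_def B_def v_def scalar_prod_def atLeast0LessThan)
      also have "\<dots> = (\<Sum>t\<in>S. of_int (u (xs ! i) t) * t)"
        using bij_betw_nth[of xs "{..<n}" S] xs
        by (intro sum.reindex_bij_betw) (simp add: n_def)
      also have "\<dots> = x * xs ! i" using u[of "xs ! i"] nth_mem[of i xs] i xs by (simp add: n_def)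
      finally show "(M *\<^sub>v v) $ i = (x \<cdot>\<^sub>v v) $ i" using i by (simp add: v_def)
    qed
  qed
  then have "poly (char_poly M) x = 0"
    using eigenvalue_root_char_poly[OF M] unfolding eigenvalue_def by blast
  moreover have "char_poly M = map_poly of_int (char_poly B)"
    unfolding M_def by (rule of_int_hom.char_poly_hom[OF B])
  moreover have "lead_coeff (char_poly B) = 1"
    using degree_monic_char_poly[OF B] by simp
  ultimately show ?thesis
    unfolding algebraic_int_altdef_ipoly by metis
qed

text \<open>The products \<open>s * x ^ j\<close> with \<open>j\<close> below the degree generate a
  module stable under \<open>x\<close>, because the monic equation rewrites \<open>x ^ d\<close>
  through lower powers. Asking only that the coefficients preserve \<open>int_span S\<close> makes
  the construction apply to integral coefficients too. The last conclusion keeps earlier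
  stabilizers, so roots can be adjoined one after another.\<close>

lemma int_span_adjoin_root:
  fixes x :: "'a::field_char_0"
  assumes fin: "finite S" and one: "1 \<in> S"
    and p: "lead_coeff p = 1" "poly p x = 0"
    and coeffs: "\<And>i s. s \<in> S \<Longrightarrow> coeff p i * s \<in> int_span S"
  obtains T where "finite T" "1 \<in> T" "\<And>t. t \<in> T \<Longrightarrow> x * t \<in> int_span T"
    "\<And>y t. (\<And>s. s \<in> S \<Longrightarrow> y * s \<in> int_span S) \<Longrightarrow> t \<in> T \<Longrightarrow> y * t \<in> int_span T"
proof
  define d where "d = degree p"
  define T where "T = (\<lambda>(s, j). s * x ^ j) ` (S \<times> {..<d})"
  have Tmem: "s * x ^ j \<in> T" if "s \<in> S" "j < d" for s j
    using that by (auto simp: T_def)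
  \<comment> \<open>A monic polynomial with a root is not constant, so \<open>j = 0\<close> is
    admissible and \<open>T\<close> contains \<open>1 * x ^ 0\<close>.\<close>
  have d: "d > 0"
    using p by (intro Nat.gr0I) (auto simp: d_def elim!: degree_eq_zeroE)
  show "finite T" using fin by (simp add: T_def)
  show "1 \<in> T" using Tmem[OF one d] Tmem[of 1 0] one d by simp
  have ext: "y * x ^ j \<in> int_span T" if "y \<in> int_span S" "j < d" for y j
  proof -
    have "(\<lambda>s. s * x ^ j) ` S \<subseteq> T" using that Tmem by auto
    then show ?thesis
      using int_span_mult_right[OF that(1)] int_module.span_mono by blast
  qed
  show "x * t \<in> int_span T" if "t \<in> T" for t
  proof -
    obtain s j where t: "t = s * x ^ j" "s \<in> S" "j < d" using \<open>t \<in> T\<close> by (auto simp: T_def)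
    show ?thesis
    proof (cases "Suc j < d")
      case True
      then have "s * x ^ Suc j \<in> T" using Tmem t by blast
      then show ?thesis using t by (simp add: int_module.span_base mult.left_commute mult.assoc)
    next
      case False
      then have j: "Suc j = d" using t by simp
      have "0 = (\<Sum>i<d. coeff p i * x ^ i) + x ^ d"
        using p by (simp add: poly_altdef d_def lessThan_Suc_atMost[symmetric])
      then have "x ^ d = - (\<Sum>i<d. coeff p i * x ^ i)"
        by (simp add: eq_neg_iff_add_eq_0 add.commute)
      then have "x * t = - (\<Sum>i<d. (coeff p i * s) * x ^ i)"
        using t j by (simp add: sum_distrib_left mult_ac flip: power_Suc)
      also have "\<dots> \<in> int_span T"
        using t(2) by (intro int_module.span_neg int_module.span_sum ext coeffs) auto
      finally show ?thesis .
    qed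
  qed
  show "y * t \<in> int_span T" if "\<And>s. s \<in> S \<Longrightarrow> y * s \<in> int_span S" "t \<in> T" for y t
    using that ext by (fastforce simp: T_def simp flip: mult.assoc)
qed

text \<open>Adjoin the elements of \<open>C\<close> one at a time; the coefficients of each monic
  equation are integers and preserve every Z-module. Sums and products of elements of
  \<open>C\<close> can then be tested on a single module.\<close>

lemma algebraic_ints_stabilize:
  fixes C :: "'a::field_char_0 set"
  assumes "finite C" "\<And>c. c \<in> C \<Longrightarrow> algebraic_int c"
  shows "\<exists>S. finite S \<and> 1 \<in> S \<and> (\<forall>c\<in>C. \<forall>s\<in>S. c * s \<in> int_span S)"
  using assms
proof (induction C rule: finite_induct)
  case empty
  show ?case by (rule exI[of _ "{1}"]) simp
next
  case (insert c C)
  then obtain S where S: "finite S" "1 \<in> S" "\<forall>c\<in>C. \<forall>s\<in>S. c * s \<in> int_span S"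
    by blast
  obtain p where p: "lead_coeff p = 1" "\<forall>i. coeff p i \<in> \<int>" "poly p c = 0"
    using insert.prems[of c] by (auto elim: algebraic_int.cases)
  have "coeff p i * s \<in> int_span S" if "s \<in> S" for i s
    using p(2) that by (metis Ints_cases int_module.span_base int_module.span_scale)
  then obtain T where "finite T" "1 \<in> T" "\<And>t. t \<in> T \<Longrightarrow> c * t \<in> int_span T"
    "\<And>y t. (\<And>s. s \<in> S \<Longrightarrow> y * s \<in> int_span S) \<Longrightarrow> t \<in> T \<Longrightarrow> y * t \<in> int_span T"
    using int_span_adjoin_root[OF S(1,2) p(1,3)] by metis
  then show ?case using S(3) by (intro exI[of _ T]) auto
qed

lemma algebraic_int_add:
  fixes x y :: "'a::field_char_0"
  assumes "algebraic_int x" "algebraic_int y"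
  shows "algebraic_int (x + y)"
proof -
  obtain S where S: "finite S" "1 \<in> S" "\<forall>c\<in>{x, y}. \<forall>s\<in>S. c * s \<in> int_span S"
    using algebraic_ints_stabilize[of "{x, y}"] assms by auto
  show ?thesis
    by (rule algebraic_int_of_int_span[OF S(1,2)])
      (use S(3) in \<open>simp add: distrib_right int_module.span_add\<close>)
qed

lemma algebraic_int_mult:
  fixes x y :: "'a::field_char_0"
  assumes "algebraic_int x" "algebraic_int y"
  shows "algebraic_int (x * y)"
proof -
  obtain S where S: "finite S" "1 \<in> S" "\<forall>c\<in>{x, y}. \<forall>s\<in>S. c * s \<in> int_span S"
    using algebraic_ints_stabilize[of "{x, y}"] assms by auto
  \<comment> \<open>As \<open>y * s\<close> lies only in the span of \<open>S\<close>, stability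
    under \<open>x\<close> is first extended from the generators to their span.\<close>
  have "x * z \<in> int_span S" if "z \<in> int_span S" for z
  proof -
    have "z * x \<in> int_span ((\<lambda>s. s * x) ` S)" by (rule int_span_mult_right[OF that])
    also have "\<dots> \<subseteq> int_span S"
      using S(3) by (intro int_module.span_minimal int_module.subspace_span) (auto simp: mult.commute[of _ x])
    finally show ?thesis by (simp add: mult.commute)
  qed
  then show ?thesis
    by (intro algebraic_int_of_int_span[OF S(1,2)]) (use S(3) in \<open>simp add: mult.assoc\<close>)
qed

lemma algebraic_int_diff:
  fixes x y :: "'a::field_char_0"
  assumes "algebraic_int x" "algebraic_int y"
  shows "algebraic_int (x - y)"
  using algebraic_int_add[of x "- y"] assms by auto

lemma algebraic_int_power_nat:
  fixes x :: "'a::field_char_0"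
  assumes "algebraic_int x"
  shows "algebraic_int (x ^ n)"
  by (induction n) (auto intro: algebraic_int_mult assms)

text \<open>Transitivity of integrality: start from a module preserved by all coefficients and
  adjoin \<open>x\<close> to it.\<close>

lemma algebraic_int_integrally_closed:
  fixes x :: "'a::field_char_0"
  assumes p: "lead_coeff p = 1" "poly p x = 0" and coeffs: "\<And>i. algebraic_int (coeff p i)"
  shows "algebraic_int x"
proof -
  obtain S where S: "finite S" "1 \<in> S" "\<forall>c\<in>coeff p ` {..degree p}. \<forall>s\<in>S. c * s \<in> int_span S"
    using algebraic_ints_stabilize[of "coeff p ` {..degree p}"] coeffs by blast
  have "coeff p i * s \<in> int_span S" if "s \<in> S" for i s
  proof (cases "i \<le> degree p")
    case True
    then show ?thesis using S(3) that by blast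
  next
    case False
    then show ?thesis by (simp add: coeff_eq_0 int_module.span_zero)
  qed
  then obtain T where "finite T" "1 \<in> T" "\<And>t. t \<in> T \<Longrightarrow> x * t \<in> int_span T"
    using int_span_adjoin_root[OF S(1,2) p] by metis
  then show ?thesis by (rule algebraic_int_of_int_span)
qed

text \<open>With \<open>c\<close> the leading coefficient and \<open>n + 1\<close> the degree,
  multiplying the equation \<open>h(x) = 0\<close> by \<open>c ^ n\<close> gives a monic equation
  for \<open>c * x\<close>.\<close>

lemma algebraic_int_lead_coeff_mult_root:
  fixes x :: "'a::field_char_0"
  assumes coeffs: "\<And>i. algebraic_int (coeff h i)" and root: "poly h x = 0"
  shows "algebraic_int (lead_coeff h * x)"
proof (cases "degree h")
  case 0
  then show ?thesis using root by (auto elim!: degree_eq_zeroE)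
next
  case (Suc n)
  define c where "c = lead_coeff h"
  define p where "p = monom 1 (Suc n) + (\<Sum>i\<le>n. monom (coeff h i * c ^ (n - i)) i)"
  have cp: "coeff p j = (if j = Suc n then 1 else if j \<le> n then coeff h j * c ^ (n - j) else 0)" for j
    by (auto simp: p_def coeff_sum)
  have "degree p = Suc n"
    by (rule antisym) (auto intro!: degree_le le_degree simp: cp)
  then have lead: "lead_coeff p = 1" by (simp add: cp)
  have "poly p (c * x) = c ^ Suc n * x ^ Suc n + (\<Sum>i\<le>n. coeff h i * (c ^ (n - i) * c ^ i) * x ^ i)"
    by (simp add: p_def poly_sum poly_monom power_mult_distrib mult_ac)
  also have "\<dots> = c ^ n * (c * x ^ Suc n + (\<Sum>i\<le>n. coeff h i * x ^ i))"
    by (simp add: distrib_left sum_distrib_left mult_ac flip: power_add)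
  also have "c * x ^ Suc n + (\<Sum>i\<le>n. coeff h i * x ^ i) = poly h x"
    by (simp add: poly_altdef Suc c_def)
  finally have "poly p (c * x) = 0" using root by simp
  moreover have "algebraic_int (coeff p i)" for i
    using coeffs by (auto simp: cp c_def intro!: algebraic_int_mult algebraic_int_power_nat)
  ultimately show ?thesis
    using algebraic_int_integrally_closed[OF lead] by (simp add: c_def)
qed

text \<open>Induction peels off the leading term \<open>c X^d\<close> of \<open>q\<close>. Here
  \<open>c\<close> is also the leading coefficient of the product, and \<open>x\<close> is a root of
  the product, so \<open>c\<close> and \<open>c * x\<close> are integral; subtracting
  \<open>(X - x) c X^d\<close> therefore leaves a product with integral coefficients.\<close>

lemma algebraic_int_coeff_divide_root:
  fixes x :: "'a::field_char_0"
  assumes "\<And>i. algebraic_int (coeff ([:- x, 1:] * q) i)"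
  shows "algebraic_int (coeff q i)"
  using assms
proof (induction "degree q" arbitrary: q i rule: less_induct)
  case less
  show ?case
  proof (cases "q = 0")
    case False
    let ?l = "[:- x, 1:]"
    define c where "c = lead_coeff q"
    define r where "r = q - monom c (degree q)"
    have lead: "lead_coeff (?l * q) = c"
      by (simp add: c_def lead_coeff_mult del: mult_pCons_left)
    have "algebraic_int c" using less.prems[of "degree (?l * q)"] lead by simp
    have "algebraic_int (c * x)"
      using algebraic_int_lead_coeff_mult_root[of "?l * q" x] less.prems lead by simp
    have lr: "?l * r = ?l * q - (monom c (Suc (degree q)) - monom (c * x) (degree q))"
      by (simp add: r_def algebra_simps smult_monom monom_Suc smult_diff_right minus_monom)
    have ir: "algebraic_int (coeff (?l * r) i)" for i
      unfolding lr coeff_diff coeff_monom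
      using \<open>algebraic_int c\<close> \<open>algebraic_int (c * x)\<close>
      by (intro algebraic_int_diff less.prems) auto
    have "algebraic_int (coeff r i)"
    proof (cases "degree q = 0")
      case True
      then have "r = 0" by (auto simp: r_def c_def monom_0 elim!: degree_eq_zeroE)
      then show ?thesis by simp
    next
      case False
      have "degree r < degree q"
      proof (rule degree_lessI)
        show "r \<noteq> 0 \<or> 0 < degree q" using False by simp
        show "\<forall>k\<ge>degree q. coeff r k = 0"
          by (auto simp: r_def c_def coeff_eq_0)
      qed
      then show ?thesis using less.hyps ir by blast
    qed
    then have "algebraic_int (coeff r i + coeff (monom c (degree q)) i)"
      using \<open>algebraic_int c\<close> by (intro algebraic_int_add) auto
    then show ?thesis by (simp add: r_def)
  qed simp
qed

text \<open>Dedekind's Prague theorem, by induction on the degree. Splitting off a root \<open>x\<close> of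
  \<open>f = (X - x) f\<^sub>1\<close>, both \<open>f\<^sub>1 g\<close> and \<open>x f\<^sub>1 g\<close> are again integral, and the coefficients
  of \<open>f\<close> are combinations of those of \<open>f\<^sub>1\<close> and \<open>x f\<^sub>1\<close>.\<close>

lemma algebraic_int_coeff_mult_coeff:
  fixes f g :: "complex poly"
  assumes "\<And>i. algebraic_int (coeff (f * g) i)"
  shows "algebraic_int (coeff f i * coeff g j)"
  using assms
proof (induction "degree f" arbitrary: f g i j)
  case 0
  then obtain a where f: "f = [:a:]" by (metis degree_eq_zeroE)
  have "algebraic_int (coeff ([:a:] * g) j)" using "0.prems"[of j] f by simp
  then show ?case by (cases i) (simp_all add: f)
next
  case (Suc n)
  then have "\<not> constant (poly f)" by (simp add: constant_degree)
  \<comment> \<open>Algebraic closedness supplies the root; this is why the lemma is stated over the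
    complex numbers and reaches \<open>'k\<close> through \<open>emb\<close>.\<close>
  then obtain x where "poly f x = 0" using fundamental_theorem_of_algebra by blast
  then obtain q where f: "f = [:- x, 1:] * q" by (auto simp: poly_eq_0_iff_dvd)
  have "q \<noteq> 0" using Suc.hyps f by auto
  then have dq: "n = degree q"
    using Suc.hyps unfolding f by (subst (asm) degree_mult_eq) auto
  have I1: "algebraic_int (coeff (q * g) i)" for i
    using Suc.prems algebraic_int_coeff_divide_root[of x "q * g"] by (simp add: f mult.assoc del: mult_pCons_left)
  \<comment> \<open>As polynomials, \<open>x q g = X q g - f g\<close>, and multiplication by
    \<open>X\<close> merely shifts coefficients.\<close>
  have "coeff (q * Polynomial.smult x g) i = coeff (pCons 0 (q * g)) i - coeff (f * g) i" for i
    by (simp add: f algebra_simps)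
  moreover have "algebraic_int (coeff (pCons 0 (q * g)) i)" for i
    using I1 by (cases i) auto
  ultimately have I2: "algebraic_int (coeff (q * Polynomial.smult x g) i)" for i
    using Suc.prems by (auto intro: algebraic_int_diff)
  have P1: "algebraic_int (coeff q i * coeff g j)" for i
    using Suc.hyps(1)[OF dq I1] by blast
  have P2: "algebraic_int (coeff q i * (x * coeff g j))" for i
    using Suc.hyps(1)[OF dq I2, of i j] by simp
  show ?case
  proof (cases i)
    case 0
    then show ?thesis using P2[of 0] by (simp add: f mult_ac)
  next
    case (Suc m)
    then have "coeff f i * coeff g j = coeff q m * coeff g j - coeff q i * (x * coeff g j)"
      by (simp add: f algebra_simps)
    then show ?thesis using P1[of m] P2[of i] by (simp add: algebraic_int_diff)
  qed
qed

subsection \<open>Number fields and fractional ideals\<close>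

lemma Zk_submodule_Zk_span: "Zk_submodule scale (Zk_span scale S)"
  unfolding Zk_span_def hull_def Zk_submodule_def by auto

lemma Zk_span_base: "x \<in> S \<Longrightarrow> x \<in> Zk_span scale S"
  unfolding Zk_span_def by (rule hull_inc)

lemma Zk_span_minimal: "S \<subseteq> M \<Longrightarrow> Zk_submodule scale M \<Longrightarrow> Zk_span scale S \<subseteq> M"
  unfolding Zk_span_def by (rule hull_minimal)

lemma Zk_span_zero: "0 \<in> Zk_span scale S"
  and Zk_span_add: "x \<in> Zk_span scale S \<Longrightarrow> y \<in> Zk_span scale S \<Longrightarrow> x + y \<in> Zk_span scale S"
  and Zk_span_scale: "algebraic_int a \<Longrightarrow> x \<in> Zk_span scale S \<Longrightarrow> scale a x \<in> Zk_span scale S"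
  using Zk_submodule_Zk_span[of scale S] by (auto simp: Zk_submodule_def)

lemma Zk_span_sum:
  "(\<And>i. i \<in> A \<Longrightarrow> f i \<in> Zk_span scale S) \<Longrightarrow> sum f A \<in> Zk_span scale S"
  by (induction A rule: infinite_finite_induct) (auto intro: Zk_span_zero Zk_span_add)

text \<open>Iterated Bezout identity; it will put the content of an integer polynomial into a module
  that contains its coefficients.\<close>

lemma Gcd_fin_int_combination:
  fixes A :: "int set" and M :: "'k::field_char_0 set"
  assumes "finite A" "Zk_submodule (*) M" "\<And>a. a \<in> A \<Longrightarrow> of_int a \<in> M"
  shows "of_int (Gcd_fin A) \<in> M"
  using assms(1,3)
proof (induction A rule: finite_induct)
  case empty
  then show ?case using assms(2) by (simp add: Zk_submodule_def)
next
  case (insert a A)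
  obtain u v where uv: "gcd a (Gcd_fin A) = u * a + v * Gcd_fin A"
    using bezout_int[of a "Gcd_fin A"] by metis
  have "of_int u * of_int a + of_int v * (of_int (Gcd_fin A) :: 'k) \<in> M"
    using assms(2) insert unfolding Zk_submodule_def by (meson algebraic_int_of_int insertCI)
  then show ?case using uv insert.hyps(1) by simp
qed

lemma common_denominator:
  fixes u :: "'b \<Rightarrow> rat"
  assumes "finite I"
  obtains m :: int where "m \<noteq> 0" "\<And>i. i \<in> I \<Longrightarrow> of_int m * u i \<in> \<int>"
proof -
  have "\<exists>m::int. m \<noteq> 0 \<and> (\<forall>i\<in>I. of_int m * u i \<in> \<int>)"
    using assms
  proof (induction I rule: finite_induct)
    case (insert j I)
    then obtain m :: int where m: "m \<noteq> 0" "\<forall>i\<in>I. of_int m * u i \<in> \<int>" by blast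
    obtain a b :: int where ab: "u j = of_int a / of_int b" "b \<noteq> 0"
      using quotient_of_div[of "u j"] quotient_of_nonzero[of "u j"] by (metis surj_pair snd_conv)
    have "of_int (m * b) * u i \<in> \<int>" if "i \<in> I" for i
      using m(2) that by (simp add: mult.commute[of "of_int m"] mult.assoc)
    moreover have "of_int (m * b) * u j = of_int (m * a)" using ab by simp
    ultimately show ?case
      using m(1) ab(2) by (intro exI[of _ "m * b"]) (auto simp del: of_int_mult)
  qed (auto intro: exI[of _ 1])
  then show ?thesis using that by blast
qed

section \<open>The complex embedding, conjugation on the field, and invertibility of fractional
  ideals\<close>

context conj_stable_number_field
begin

lemma emb_0 [simp]: "emb 0 = 0"
  using emb_add[of 0 0] by simp

lemma emb_uminus: "emb (- x) = - emb x"
  using emb_add[of "- x" x] by (simp add: eq_neg_iff_add_eq_0)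

lemma emb_diff: "emb (x - y) = emb x - emb y"
  using emb_add[of x "- y"] by (simp add: emb_uminus)

lemma emb_eq_0_iff: "emb x = 0 \<longleftrightarrow> x = 0"
proof
  assume "emb x = 0"
  show "x = 0"
  proof (rule ccontr)
    assume "x \<noteq> 0"
    then have "emb 1 = emb x * emb (inverse x)" by (simp flip: emb_mult)
    then show False using \<open>emb x = 0\<close> by (simp add: emb_one)
  qed
qed simp

lemma inj_emb: "inj emb"
  by (rule injI) (metis emb_diff emb_eq_0_iff right_minus_eq)

lemma emb_sum: "emb (sum f A) = (\<Sum>x\<in>A. emb (f x))"
  by (induction A rule: infinite_finite_induct) (simp_all add: emb_add)

lemma emb_of_nat: "emb (of_nat n) = of_nat n"
  by (induction n) (simp_all add: emb_add emb_one)

lemma emb_of_int: "emb (of_int n) = of_int n"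
  by (cases n) (simp_all add: emb_of_nat emb_uminus emb_add emb_one emb_diff)

lemma emb_poly_of_int: "emb (poly (map_poly of_int p) x) = poly (map_poly of_int p) (emb x)"
  by (induction p) (simp_all add: map_poly_pCons emb_add emb_mult emb_of_int)

lemma algebraic_int_emb_iff: "algebraic_int (emb x) \<longleftrightarrow> algebraic_int x"
  unfolding algebraic_int_altdef_ipoly by (simp add: emb_eq_0_iff flip: emb_poly_of_int)

lemma emb_k_conj: "emb (k_conj x) = cnj (emb x)"
  unfolding k_conj_def by (rule f_the_inv_into_f[OF inj_emb]) (use cnj_stable in auto)

lemma emb_eq_iff: "emb x = emb y \<longleftrightarrow> x = y"
  using inj_emb by (auto dest: injD)

lemma k_conj_add: "k_conj (x + y) = k_conj x + k_conj y"
  and k_conj_mult: "k_conj (x * y) = k_conj x * k_conj y"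
  and k_conj_0 [simp]: "k_conj 0 = 0"
  and k_conj_k_conj [simp]: "k_conj (k_conj x) = x"
  by (rule emb_eq_iff[THEN iffD1], simp add: emb_k_conj emb_add emb_mult emb_diff emb_one)+

lemma k_conj_eq_0_iff [simp]: "k_conj x = 0 \<longleftrightarrow> x = 0"
  by (metis k_conj_0 k_conj_k_conj)

text \<open>Evaluation of integer polynomials commutes with complex conjugation. This matters
  because scalars leave the second argument of the pairing conjugated.\<close>

lemma algebraic_int_k_conj: "algebraic_int (k_conj x) \<longleftrightarrow> algebraic_int x"
proof -
  have "algebraic_int (k_conj x)" if "algebraic_int x" for x
  proof -
    obtain p where p: "poly (map_poly of_int p) (emb x) = 0" "lead_coeff p = 1"
      using \<open>algebraic_int x\<close> unfolding algebraic_int_emb_iff[symmetric] algebraic_int_altdef_ipoly by blast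
    have "poly (map_poly of_int p) (cnj z) = cnj (poly (map_poly of_int p) z)" for z
      by (induction p) (simp_all add: map_poly_pCons)
    then have "poly (map_poly of_int p) (emb (k_conj x)) = 0" using p by (simp add: emb_k_conj)
    then show ?thesis
      using p(2) unfolding algebraic_int_emb_iff[symmetric] algebraic_int_altdef_ipoly by blast
  qed
  then show ?thesis by (metis k_conj_k_conj)
qed

text \<open>Since \<open>'k\<close> has finite degree over the rationals, the residues of all powers
  \<open>X^i\<close> modulo \<open>f\<close> lie in the rational span of one finite set of
  monomials. More residues than monomials satisfy a nontrivial rational relation, and its
  coefficients are those of \<open>h\<close>.\<close>

lemma exists_rat_poly_multiple:
  fixes f :: "'k poly"
  assumes "f \<noteq> 0"
  obtains h :: "rat poly" where "h \<noteq> 0" "f dvd map_poly of_rat h"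
proof -
  interpret K: Vector_Spaces.vector_space "\<lambda>(q::rat) (x::'k). of_rat q * x"
    by standard (simp_all add: algebra_simps of_rat_add of_rat_mult)
  interpret P: Vector_Spaces.vector_space "\<lambda>(q::rat) (p::'k poly). Polynomial.smult (of_rat q) p"
    by standard (simp_all add: smult_add_left smult_add_right of_rat_add of_rat_mult)
  obtain B where B: "finite B" "K.span B = UNIV" using finite_degree by blast
  define M where "M = (\<lambda>(b, j). monom b j) ` (B \<times> {..degree f})"
  have M: "finite M" using B(1) by (simp add: M_def)
  have mono: "monom c j \<in> P.span M" if "j \<le> degree f" for c j
  proof -
    have "c \<in> K.span B" using B by simp
    then show ?thesis
    proof (induction rule: K.span_induct_alt)
      case base
      show ?case by (simp add: P.span_zero)
    next
      case (step q b y)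
      have "monom b j \<in> P.span M" using step that by (intro P.span_base) (auto simp: M_def)
      then have "Polynomial.smult (of_rat q) (monom b j) + monom y j \<in> P.span M"
        by (intro P.span_add P.span_scale step)
      then show ?case by (simp add: smult_monom add_monom)
    qed
  qed
  define g where "g i = monom 1 i mod f" for i
  have g: "g i \<in> P.span M" for i
  proof -
    have "degree (g i) \<le> degree f"
      using degree_mod_less[OF assms, of "monom 1 i"] by (auto simp: g_def)
    then have "g i = (\<Sum>j\<le>degree f. monom (coeff (g i) j) j)"
      by (simp add: poly_as_sum_of_monoms')
    also have "\<dots> \<in> P.span M" by (intro P.span_sum mono) simp
    finally show ?thesis .
  qed
  define N where "N = card M"
  show ?thesis
  \<comment> \<open>Linear dependence is a property of sets, so coinciding residues are treated
    apart: they make \<open>X^i - X^j\<close> a multiple of \<open>f\<close>.\<close>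
  proof (cases "inj_on g {..N}")
    case False
    then obtain i j where ij: "i \<noteq> j" "g i = g j" by (auto simp: inj_on_def)
    then have "f dvd monom 1 i - monom 1 j" by (simp add: g_def mod_eq_dvd_iff)
    moreover have "monom 1 i - monom 1 j = map_poly of_rat (monom (1::rat) i - monom 1 j)"
      by (rule poly_eqI) (simp add: coeff_map_poly of_rat_diff)
    moreover have "monom (1::rat) i - monom 1 j \<noteq> 0" 
      using ij(1) by (auto simp: poly_eq_iff intro!: exI[of _ i])
    ultimately show ?thesis using that by metis
  next
    case True
    have "P.dependent (g ` {..N})"
    proof (rule ccontr)
      assume "\<not> ?thesis"
      then have "card (g ` {..N}) \<le> card M"
        using P.independent_span_bound[OF M, of "g ` {..N}"] g by blast
      then show False using True by (simp add: card_image N_def)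
    qed
    then obtain u i where u: "i \<le> N" "u (g i) \<noteq> 0"
      "(\<Sum>v\<in>g ` {..N}. Polynomial.smult (of_rat (u v)) v) = 0"
      using P.dependent_finite[of "g ` {..N}"] by blast
    define h where "h = (\<Sum>i\<le>N. monom (u (g i)) i)"
    have ch: "coeff h j = (if j \<le> N then u (g j) else 0)" for j
      by (simp add: h_def coeff_sum)
    have "h \<noteq> 0" using u ch[of i] by auto
    have hmap: "map_poly of_rat h = (\<Sum>i\<le>N. Polynomial.smult (of_rat (u (g i))) (monom 1 i))"
      by (rule poly_eqI) (simp add: coeff_map_poly ch coeff_sum smult_monom)
    have sum_mod: "sum F A mod f = (\<Sum>i\<in>A. F i mod f)" for F :: "nat \<Rightarrow> 'k poly" and A
      by (induction A rule: infinite_finite_induct) (simp_all add: poly_mod_add_left)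
    have "map_poly of_rat h mod f = (\<Sum>i\<le>N. Polynomial.smult (of_rat (u (g i))) (g i))"
      unfolding hmap by (simp add: sum_mod mod_smult_left g_def)
    also have "\<dots> = 0" using u(3) True by (simp add: sum.reindex)
    finally have "f dvd map_poly of_rat h" by (simp add: mod_eq_0_iff_dvd)
    then show ?thesis using that \<open>h \<noteq> 0\<close> by blast
  qed
qed

text \<open>Clear denominators and divide by the content. Both operations scale by nonzero
  constants, which are units in the polynomial ring over \<open>'k\<close>, so divisibility by
  \<open>f\<close> survives.\<close>

lemma exists_primitive_multiple:
  fixes f :: "'k poly"
  assumes "f \<noteq> 0"
  obtains h :: "int poly" where "content h = 1" "f dvd map_poly of_int h"
proof -
  obtain r :: "rat poly" where r: "r \<noteq> 0" "f dvd map_poly of_rat r"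
    using exists_rat_poly_multiple[OF assms] .
  obtain m :: int where m: "m \<noteq> 0" "\<And>i. i \<in> {..degree r} \<Longrightarrow> of_int m * coeff r i \<in> \<int>"
    using common_denominator[of "{..degree r}" "coeff r"] by auto
  \<comment> \<open>The floor is exact on the coefficients of \<open>r\<close>, because
    \<open>m\<close> clears their denominators.\<close>
  define h where "h = map_poly (\<lambda>q. \<lfloor>of_int m * q\<rfloor>) r"
  have h: "of_int (coeff h i) = of_int m * coeff r i" for i
  proof (cases "i \<le> degree r")
    case True
    then show ?thesis using m(2)[of i] by (auto simp: h_def coeff_map_poly elim!: Ints_cases)
  qed (simp add: h_def coeff_map_poly coeff_eq_0)
  have "h \<noteq> 0" using r(1) m(1) h[of "degree r"] by auto
  have "map_poly of_int h = Polynomial.smult (of_int m) (map_poly of_rat r :: 'k poly)"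
  proof (rule poly_eqI)
    fix i
    have "(of_int (coeff h i) :: 'k) = of_rat (of_int (coeff h i))" by simp
    also have "\<dots> = of_int m * of_rat (coeff r i)" by (simp add: h of_rat_mult)
    finally show "coeff (map_poly of_int h) i = coeff (Polynomial.smult (of_int m) (map_poly of_rat r :: 'k poly)) i"
      by (simp add: coeff_map_poly)
  qed
  then have "f dvd map_poly of_int h" using r(2) by (simp add: dvd_smult)
  moreover have "map_poly of_int h = Polynomial.smult (of_int (content h)) (map_poly of_int (primitive_part h) :: 'k poly)"
    by (subst content_times_primitive_part[of h, symmetric], rule poly_eqI)
      (simp add: coeff_map_poly del: content_times_primitive_part)
  ultimately have "f dvd map_poly of_int (primitive_part h)"
    using \<open>h \<noteq> 0\<close> by (simp add: dvd_smult_iff)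
  moreover have "content (primitive_part h) = 1" using \<open>h \<noteq> 0\<close> by simp
  ultimately show ?thesis using that by blast
qed

text \<open>Let \<open>f\<close> have the generators of the ideal as coefficients. If \<open>f g\<close> is a primitive integer
  polynomial, then the coefficients of \<open>g\<close> generate the inverse.\<close>

lemma fractional_ideal_inverse:
  fixes A :: "'k set"
  assumes "finite A" "a \<in> A" "a \<noteq> 0"
  obtains B where "finite B" "\<And>a b. a \<in> A \<Longrightarrow> b \<in> B \<Longrightarrow> algebraic_int (a * b)"
    "1 \<in> Zk_span (*) {a * b |a b. a \<in> A \<and> b \<in> B}"
proof -
  obtain as where as: "set as = A" using finite_list[OF assms(1)] by blast
  define f where "f = Poly as"
  have f_coeff: "\<exists>i. coeff f i = a" if "a \<in> A" for a
    using that as by (metis f_def coeff_Poly_eq in_set_conv_nth nth_default_nth)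
  have f_mem: "coeff f i = 0 \<or> coeff f i \<in> A" for i
    using as by (auto simp: f_def nth_default_def)
  have "f \<noteq> 0" using f_coeff[OF assms(2)] assms(3) by auto
  then obtain h :: "int poly" where h: "content h = 1" "f dvd map_poly of_int h"
    using exists_primitive_multiple by blast
  then obtain g where g: "map_poly of_int h = f * g" by blast
  define B where "B = set (coeffs g)"
  have g_mem: "coeff g i = 0 \<or> coeff g i \<in> B" for i
    by (metis B_def coeff_0 coeff_eq_0 coeff_in_coeffs le_degree)
  \<comment> \<open>Both factors are moved to the complex numbers, where Dedekind's theorem is
    available.\<close>
  have "map_poly emb f * map_poly emb g = map_poly emb (f * g)"
    by (rule poly_eqI) (simp add: coeff_mult coeff_map_poly emb_sum emb_mult)
  then have int: "algebraic_int (coeff (map_poly emb f * map_poly emb g) i)" for i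
    by (simp add: coeff_map_poly emb_of_int flip: g)
  have "algebraic_int (coeff f i * coeff g j)" for i j
    using algebraic_int_coeff_mult_coeff[OF int, of i j]
    by (simp add: coeff_map_poly flip: emb_mult add: algebraic_int_emb_iff)
  moreover have "\<exists>j. b = coeff g j" if "b \<in> B" for b
    using that by (auto simp: B_def coeffs_def split: if_splits)
  ultimately have AB: "algebraic_int (a * b)" if "a \<in> A" "b \<in> B" for a b
    using that f_coeff by metis
  define M where "M = Zk_span (*) {a * b |a b. a \<in> A \<and> b \<in> B}"
  have prod: "coeff f i * coeff g j \<in> M" for i j
  proof (cases "coeff f i = 0 \<or> coeff g j = 0")
    case False
    then show ?thesis unfolding M_def using f_mem[of i] g_mem[of j] by (blast intro: Zk_span_base)
  qed (auto simp: M_def Zk_span_zero)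
  have "of_int (coeff h n) \<in> M" for n
  proof -
    have "of_int (coeff h n) = coeff (f * g) n" by (simp add: coeff_map_poly flip: g)
    also have "\<dots> \<in> M" unfolding coeff_mult using prod by (simp add: M_def Zk_span_sum)
    finally show ?thesis .
  qed
  \<comment> \<open>Each coefficient of \<open>h\<close> is a sum of products of coefficients of
    \<open>f\<close> and \<open>g\<close>, so Bezout puts their gcd, which is 1, into
    \<open>M\<close>.\<close>
  then have "of_int (content h) \<in> M"
    unfolding content_def M_def
    by (intro Gcd_fin_int_combination Zk_submodule_Zk_span) (auto simp: coeffs_def split: if_splits)
  then have "1 \<in> M" using h(1) by simp
  then show ?thesis using that AB by (auto simp: B_def M_def)
qed

end

subsection \<open>Reflections and Hermitian pairings\<close>

lemma GL_simps [simp]: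
  "g \<in> carrier (GL scale) \<longleftrightarrow> Vector_Spaces.linear scale scale g \<and> bij g"
  "monoid.mult (GL scale) = (\<circ>)" "one (GL scale) = id"
  by (auto simp: GL_def)

lemma (in Vector_Spaces.vector_space) linear_inv_into:
  assumes "Vector_Spaces.linear scale scale g" "bij g"
  shows "Vector_Spaces.linear scale scale (inv_into UNIV g)"
proof -
  interpret g: Vector_Spaces.linear scale scale g by fact
  have r: "g (inv_into UNIV g x) = x" for x using assms(2) by (simp add: bij_is_surj surj_f_inv_f)
  have l: "inv_into UNIV g (g x) = x" for x using assms(2) by (simp add: bij_is_inj)
  show ?thesis
    by standard (metis g.add l r, metis g.scale l r)
qed

lemma (in Vector_Spaces.vector_space) group_GL: "group (GL scale)"
proof (rule groupI)
  show "\<one>\<^bsub>GL scale\<^esub> \<in> carrier (GL scale)"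
    by (simp add: linear_id)
  show "x \<otimes>\<^bsub>GL scale\<^esub> y \<in> carrier (GL scale)"
    if "x \<in> carrier (GL scale)" "y \<in> carrier (GL scale)" for x y
    using that by (auto intro: Vector_Spaces.linear_compose bij_comp)
  show "\<exists>y\<in>carrier (GL scale). y \<otimes>\<^bsub>GL scale\<^esub> x = \<one>\<^bsub>GL scale\<^esub>"
    if "x \<in> carrier (GL scale)" for x
    using that linear_inv_into
    by (intro bexI[of _ "inv_into UNIV x"]) (auto simp: bij_is_inj bij_imp_bij_inv)
qed (auto simp: comp_assoc)

lemma (in Vector_Spaces.vector_space) inv_GL:
  assumes "g \<in> carrier (GL scale)"
  shows "inv\<^bsub>GL scale\<^esub> g = inv_into UNIV g"
  using assms linear_inv_into
  by (intro group.inv_equality[OF group_GL]) (auto simp: bij_is_inj bij_imp_bij_inv)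

lemma finite_roots_of_unity:
  assumes "m > 0"
  shows "finite {x::'a::field. x ^ m = 1}"
proof -
  let ?p = "monom (1::'a) m - 1"
  have "coeff ?p m = 1" using assms by simp
  then have "?p \<noteq> 0" by (metis coeff_0 zero_neq_one)
  then have "finite {x. poly ?p x = 0}" by (rule poly_roots_finite)
  then show ?thesis by (simp add: poly_monom)
qed

section \<open>Annihilators, representable functionals, contragredients and reflections\<close>

context hermitian_pairing
begin

lemma pair_0_left [simp]: "pair 0 w = 0"
  and pair_0_right [simp]: "pair v 0 = 0"
  using pair_add_left[of 0 0 w] pair_add_right[of v 0 0] by simp_all

lemma pair_uminus_left: "pair (- v) w = - pair v w"
  using pair_add_left[of "- v" v w] by (simp add: eq_neg_iff_add_eq_0)

lemma pair_diff_left: "pair (v - v') w = pair v w - pair v' w"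
  using pair_add_left[of v "- v'" w] by (simp add: pair_uminus_left)

lemma pair_diff_right: "pair v (w - w') = pair v w - pair v w'"
  using pair_add_right[of v "w - w'" w'] by (simp add: eq_diff_eq)

lemma pair_sum_right: "pair v (sum f A) = (\<Sum>x\<in>A. pair v (f x))"
  by (induction A rule: infinite_finite_induct) (simp_all add: pair_add_right)

lemma pair_right_cancel: "(\<And>v. pair v w = pair v w') \<Longrightarrow> w = w'"
  using nondegenerate_right[of "w - w'"] by (simp add: pair_diff_right)

text \<open>Double annihilator property, by induction on \<open>B\<close>. If some \<open>w0\<close>
  kills \<open>B\<close> but not \<open>c\<close>, subtracting a multiple of \<open>c\<close> from
  \<open>x\<close> reduces to \<open>B\<close>; otherwise everything that kills \<open>B\<close>
  also kills \<open>c\<close>, and the induction hypothesis applies to \<open>x\<close>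
  itself.\<close>

lemma in_span_if_pair_zero:
  assumes "finite B" "\<And>w. (\<And>b. b \<in> B \<Longrightarrow> pair b w = 0) \<Longrightarrow> pair x w = 0"
  shows "x \<in> V.span B"
  using assms
proof (induction B arbitrary: x rule: finite_induct)
  case empty
  then show ?case using nondegenerate_left[of x] by simp
next
  case (insert c B)
  show ?case
  proof (cases "\<exists>w. (\<forall>b\<in>B. pair b w = 0) \<and> pair c w \<noteq> 0")
    case True
    then obtain w0 where w0: "\<And>b. b \<in> B \<Longrightarrow> pair b w0 = 0" "pair c w0 \<noteq> 0" by blast
    define a where "a = pair x w0 / pair c w0"
    have "x - scaleV a c \<in> V.span B"
    proof (rule insert.IH)
      fix w assume w: "\<And>b. b \<in> B \<Longrightarrow> pair b w = 0"
      \<comment> \<open>Correcting \<open>w\<close> by a multiple of \<open>w0\<close> makes it kill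
        \<open>c\<close> as well; the multiple is conjugated because the pairing is semilinear on
        the right.\<close>
      define q where "q = pair c w / pair c w0"
      have "pair x (w - scaleW (k_conj q) w0) = 0"
        by (rule insert.prems) (use w w0 in \<open>auto simp: pair_diff_right pair_scale_right q_def\<close>)
      then show "pair (x - scaleV a c) w = 0"
        using w0(2) by (simp add: pair_diff_left pair_diff_right pair_scale_left pair_scale_right a_def q_def mult.commute)
    qed
    then show ?thesis using V.span_breakdown_eq by blast
  next
    case False
    then have "x \<in> V.span B" using insert.prems by (intro insert.IH) auto
    then show ?thesis using V.span_mono[of B "insert c B"] by blast
  qed
qed

lemma finite_basis_V:
  obtains B where "finite_dimensional_vector_space scaleV B"
proof -
  obtain B0 where B0: "finite B0" "V.span B0 = UNIV" using finite_dim_V by blast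
  obtain B where B: "B \<subseteq> B0" "V.independent B" "B0 \<subseteq> V.span B"
    using V.maximal_independent_subset[of B0] by blast
  have "V.span B = UNIV"
    using B0(2) B(3) V.span_mono[of B0 "V.span B"] V.span_span by auto
  then have "finite_dimensional_vector_space scaleV B"
    using B B0(1) by unfold_locales (auto intro: finite_subset)
  then show ?thesis by (rule that)
qed

text \<open>A basis of \<open>V\<close> has a dual basis \<open>d\<close> in \<open>W\<close>: a
  basis vector is outside the span of the others, so the double annihilator property yields a vector
  that kills the others but not it. The functional is then a combination of the \<open>d b\<close>
  with conjugated values as coefficients.\<close>

lemma functional_representable:
  assumes add: "\<And>x y. f (x + y) = f x + f y" and scale: "\<And>a x. f (scaleV a x) = a * f x"
  shows "\<exists>w. \<forall>v. pair v w = f v"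
proof -
  obtain B where "finite_dimensional_vector_space scaleV B" using finite_basis_V .
  then interpret fd: finite_dimensional_vector_space scaleV B .
  have "\<exists>w. pair b w = 1 \<and> (\<forall>b'\<in>B - {b}. pair b' w = 0)" if "b \<in> B" for b
  proof -
    have "b \<notin> V.span (B - {b})" using fd.independent_Basis that V.dependent_def by blast
    then obtain w where w: "\<And>b'. b' \<in> B - {b} \<Longrightarrow> pair b' w = 0" "pair b w \<noteq> 0"
      using in_span_if_pair_zero[of "B - {b}" b] fd.finite_Basis by blast
    then show ?thesis
      by (intro exI[of _ "scaleW (k_conj (inverse (pair b w))) w"]) (simp add: pair_scale_right)
  qed
  then obtain d where d: "\<And>b. b \<in> B \<Longrightarrow> pair b (d b) = 1"
    "\<And>b b'. b \<in> B \<Longrightarrow> b' \<in> B \<Longrightarrow> b' \<noteq> b \<Longrightarrow> pair b' (d b) = 0"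
    by (metis Diff_iff singletonD)
  define w where "w = (\<Sum>b\<in>B. scaleW (k_conj (f b)) (d b))"
  have base: "pair b w = f b" if "b \<in> B" for b
  proof -
    have "pair b w = (\<Sum>b'\<in>B. f b' * pair b (d b'))"
      by (simp add: w_def pair_sum_right pair_scale_right)
    also have "\<dots> = (\<Sum>b'\<in>B. if b' = b then f b else 0)"
      using d that by (intro sum.cong) auto
    finally show ?thesis using that fd.finite_Basis by simp
  qed
  have "pair v w = f v" if "v \<in> V.span B" for v
    using that
  proof (induction rule: V.span_induct_alt)
    case base
    then show ?case using add[of 0 0] by simp
  next
    case (step c x y)
    then show ?case using base by (simp add: pair_add_left pair_scale_left add scale)
  qed
  then show ?thesis using fd.span_Basis by blast
qed

text \<open>Let \<open>h w\<close> represent the functional that sends \<open>v\<close> to the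
  pairing of the preimage of \<open>v\<close> under \<open>g\<close> with \<open>w\<close>.\<close>

lemma dual_pair_exists:
  assumes "g \<in> carrier (GL scaleV)"
  shows "\<exists>h. Vector_Spaces.linear scaleW scaleW h \<and> (\<forall>v w. pair (g v) (h w) = pair v w)"
proof -
  let ?i = "inv_into UNIV g"
  interpret i: Vector_Spaces.linear scaleV scaleV ?i using assms V.linear_inv_into by simp
  have "\<exists>h. \<forall>v. pair v h = pair (?i v) w" for w
    by (rule functional_representable)
      (simp_all add: i.add i.scale pair_add_left pair_scale_left)
  then obtain h where h: "\<And>v w. pair v (h w) = pair (?i v) w" by metis
  have "Vector_Spaces.linear scaleW scaleW h"
    by unfold_locales (rule pair_right_cancel; simp add: h pair_add_right pair_scale_right)+
  moreover have "pair (g v) (h w) = pair v w" for v w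
    using assms h by (simp add: bij_is_inj)
  ultimately show ?thesis by blast
qed

text \<open>Discharges the definite description in \<open>dual\<close>. The map obtained for the
  inverse of \<open>g\<close> is a two-sided inverse of \<open>h\<close>, so \<open>h\<close> is
  bijective; uniqueness follows from non-degeneracy and surjectivity of \<open>g\<close>.\<close>

lemma dual_works:
  assumes g: "g \<in> carrier (GL scaleV)"
  shows dual_in_GL: "dual g \<in> carrier (GL scaleW)" and pair_dual: "pair (g v) (dual g w) = pair v w"
proof -
  obtain h where h: "Vector_Spaces.linear scaleW scaleW h" "\<And>v w. pair (g v) (h w) = pair v w"
    using dual_pair_exists[OF g] by blast
  have gi: "inv_into UNIV g \<in> carrier (GL scaleV)"
    using g V.linear_inv_into by (simp add: bij_imp_bij_inv)
  obtain h' where h': "\<And>v w. pair (inv_into UNIV g v) (h' w) = pair v w"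
    using dual_pair_exists[OF gi] by blast
  have surj: "\<exists>u. v = g u" for v using g by (metis GL_simps(1) bij_pointE)
  have "h' (h w) = w" for w
    by (rule pair_right_cancel) (metis h' h(2) surj g GL_simps(1) bij_is_inj inv_f_f)
  moreover have "h (h' w) = w" for w
    by (rule pair_right_cancel) (metis h' h(2) surj g GL_simps(1) bij_is_inj inv_f_f)
  ultimately have "bij h" by (metis bij_betw_byWitness subset_UNIV UNIV_I)
  then have ex: "h \<in> carrier (GL scaleW) \<and> (\<forall>v w. pair (g v) (h w) = pair v w)"
    using h by simp
  have "k = h" if "k \<in> carrier (GL scaleW) \<and> (\<forall>v w. pair (g v) (k w) = pair v w)" for k
  proof
    fix w show "k w = h w"
      by (rule pair_right_cancel) (metis that h(2) surj)
  qed
  from theI2[where P = "\<lambda>h. h \<in> carrier (GL scaleW) \<and> (\<forall>v w. pair (g v) (h w) = pair v w)"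
      and Q = "\<lambda>h. h \<in> carrier (GL scaleW) \<and> (\<forall>v w. pair (g v) (h w) = pair v w)", OF ex this]
  have "dual g \<in> carrier (GL scaleW) \<and> (\<forall>v w. pair (g v) (dual g w) = pair v w)"
    unfolding dual_def by blast
  then show "dual g \<in> carrier (GL scaleW)" "pair (g v) (dual g w) = pair v w" by auto
qed

text \<open>The kernel of \<open>w\<close> is fixed pointwise, and \<open>v\<close> is an
  eigenvector with eigenvalue \<open>1 - pair v w\<close>.\<close>

definition reflect :: "'v \<Rightarrow> 'w \<Rightarrow> 'v \<Rightarrow> 'v"
  where "reflect v w x = x - scaleV (pair x w) v"

lemma linear_reflect: "Vector_Spaces.linear scaleV scaleV (reflect v w)"
  by unfold_locales
    (simp_all add: reflect_def pair_add_left pair_scale_left V.scale_left_distrib V.scale_right_diff_distrib)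

lemma reflect_conjugate:
  assumes "g \<in> carrier (GL scaleV)"
  shows "g \<circ> reflect v w = reflect (g v) (dual g w) \<circ> g"
proof -
  interpret g: Vector_Spaces.linear scaleV scaleV g using assms by simp
  show ?thesis by (rule ext) (simp add: reflect_def g.diff g.scale pair_dual[OF assms])
qed

text \<open>The map determines its root line, as evaluating both expressions at \<open>v\<close>
  shows.\<close>

lemma reflect_eqD:
  assumes "reflect v w = reflect v' w'" "pair v w \<noteq> 0"
  obtains c where "c \<noteq> 0" "v = scaleV c v'"
proof
  have "scaleV (pair v w) v = scaleV (pair v w') v'"
    using fun_cong[OF assms(1), of v] by (simp add: reflect_def)
  then have "scaleV (inverse (pair v w)) (scaleV (pair v w) v)
      = scaleV (inverse (pair v w)) (scaleV (pair v w') v')" by simp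
  then show eq: "v = scaleV (pair v w' / pair v w) v'"
    using assms(2) by (simp add: field_simps)
  show "pair v w' / pair v w \<noteq> 0"
    using assms(2) eq by (metis V.scale_zero_left pair_0_left)
qed

text \<open>Each application multiplies the pairing with \<open>w\<close> by the eigenvalue \<zeta>,
  so the displacements along \<open>v\<close> add up to a geometric sum.\<close>

lemma reflect_power:
  assumes "pair v w = 1 - \<zeta>"
  shows "(reflect v w ^^ n) x = x - scaleV ((\<Sum>i<n. \<zeta> ^ i) * pair x w) v"
proof (induction n)
  case (Suc n)
  let ?c = "(\<Sum>i<n. \<zeta> ^ i) * pair x w"
  have "pair (x - scaleV ?c v) w = \<zeta> ^ n * pair x w"
  proof -
    have "(\<Sum>i<n. \<zeta> ^ i) * (1 - \<zeta>) = 1 - \<zeta> ^ n"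
      using one_diff_power_eq[of \<zeta> n] by (simp add: mult.commute)
    then have "pair (x - scaleV ?c v) w = pair x w - (1 - \<zeta> ^ n) * pair x w"
      using assms by (simp add: pair_diff_left pair_scale_left)
    then show ?thesis by (simp add: algebra_simps)
  qed
  then have "(reflect v w ^^ Suc n) x = x - scaleV ?c v - scaleV (\<zeta> ^ n * pair x w) v"
    using Suc reflect_def[of v w "(reflect v w ^^ n) x"] by simp
  then show ?case
    by (simp add: V.scale_left_distrib distrib_right diff_diff_eq)
qed simp

lemma reflect_power_eq_id:
  assumes "pair v w = 1 - \<zeta>" "\<zeta> \<noteq> 1" "\<zeta> ^ n = 1"
  shows "reflect v w ^^ n = id"
proof -
  have "(\<Sum>i<n. \<zeta> ^ i) = 0"
    using assms one_diff_power_eq[of \<zeta> n] by simp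
  then show ?thesis by (intro ext) (simp add: reflect_power[OF assms(1)])
qed

lemma bij_if_power_eq_id:
  assumes "f ^^ n = id" "n > 0"
  shows "bij f"
proof -
  obtain m where "n = Suc m" using assms(2) gr0_conv_Suc by blast
  then have "f ^^ m \<circ> f = id" "f \<circ> f ^^ m = id"
    using assms(1) by (simp_all add: funpow_swap1 fun_eq_iff)
  then show ?thesis by (rule o_bij)
qed

text \<open>The fixed space is the kernel of \<open>w\<close>. It misses \<open>v\<close>, and
  together with \<open>v\<close> it spans everything, so it has codimension one.\<close>

lemma is_reflection_reflect:
  assumes "pair v w = 1 - \<zeta>" "\<zeta> \<noteq> 1" "\<zeta> ^ n = 1" "n > 0"
  shows "is_reflection scaleV (reflect v w)"
proof -
  obtain B where "finite_dimensional_vector_space scaleV B" using finite_basis_V .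
  then interpret fd: finite_dimensional_vector_space scaleV B .
  have pow: "reflect v w ^^ n = id" by (rule reflect_power_eq_id[OF assms(1-3)])
  have vw: "pair v w \<noteq> 0" using assms by simp
  then have "v \<noteq> 0" by auto
  define H where "H = {x. reflect v w x = x}"
  have H: "H = {x. pair x w = 0}" using \<open>v \<noteq> 0\<close> by (auto simp: H_def reflect_def)
  have sub: "V.subspace H"
    by (rule V.subspaceI) (simp_all add: H pair_add_left pair_scale_left)
  then have "v \<notin> V.span H" using vw by (simp add: V.span_eq_iff[THEN iffD2] H)
  then have "V.dim (insert v H) = V.dim H + 1" by (simp add: fd.dim_insert)
  moreover have "x \<in> V.span (insert v H)" for x
  proof -
    have "x - scaleV (pair x w / pair v w) v \<in> H"
      using vw by (simp add: H pair_diff_left pair_scale_left)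
    then show ?thesis using V.span_base V.span_breakdown_eq by blast
  qed
  then have "V.span (insert v H) = UNIV" by blast
  then have "V.dim (insert v H) = V.dim (UNIV :: 'v set)" by (metis V.dim_span)
  ultimately show ?thesis
    using linear_reflect bij_if_power_eq_id[OF pow assms(4)] pow assms(4)
    unfolding is_reflection_def H_def[symmetric] by auto
qed

text \<open>For \<open>u\<close> outside the fixed hyperplane \<open>H\<close>, the coefficient of
  \<open>u\<close> modulo \<open>H\<close> is a linear functional, hence given by some
  \<open>w\<close>; comparing the values on \<open>H\<close> and at \<open>u\<close> forces
  \<open>v = u - s u\<close>.\<close>

lemma is_reflection_imp_reflect:
  assumes "is_reflection scaleV s"
  obtains v w \<zeta> n where "s = reflect v w" "pair v w = 1 - \<zeta>" "\<zeta> \<noteq> 1" "\<zeta> ^ n = 1" "n > 0"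
proof -
  obtain B where "finite_dimensional_vector_space scaleV B" using finite_basis_V .
  then interpret fd: finite_dimensional_vector_space scaleV B .
  define H where "H = {x. s x = x}"
  obtain n where s: "Vector_Spaces.linear scaleV scaleV s" "n > 0" "s ^^ n = id"
    and dimH: "V.dim H + 1 = V.dim (UNIV :: 'v set)"
    using assms by (auto simp: is_reflection_def H_def)
  interpret s: Vector_Spaces.linear scaleV scaleV s by fact
  have sub: "V.subspace H"
    by (rule V.subspaceI) (simp_all add: H_def s.add s.scale s.zero)
  have "H \<noteq> UNIV" using dimH by auto
  then obtain u where u: "u \<notin> H" by blast
  then have "u \<notin> V.span H" using sub by (simp add: V.span_eq_iff[THEN iffD2])
  then have "V.dim (insert u H) = V.dim (UNIV :: 'v set)" using dimH by (simp add: fd.dim_insert)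
  then have span: "V.span (insert u H) = UNIV" by (simp add: fd.dimension_def flip: fd.dim_eq_full)
  have ex: "\<exists>a. x - scaleV a u \<in> H" for x
  proof -
    have "x \<in> V.span (insert u H)" using span by blast
    then obtain a where "x - scaleV a u \<in> V.span H" using V.span_breakdown_eq by blast
    then show ?thesis using sub by (metis V.span_eq_iff)
  qed
  then obtain f where f: "\<And>x. x - scaleV (f x) u \<in> H" by metis
  have f_unique: "a = f x" if "x - scaleV a u \<in> H" for a x
  proof (rule ccontr)
    assume "a \<noteq> f x"
    have "(x - scaleV (f x) u) - (x - scaleV a u) \<in> H" using V.subspace_diff[OF sub f that] .
    then have "scaleV (a - f x) u \<in> H" by (simp add: V.scale_left_diff_distrib)
    then have "scaleV (inverse (a - f x)) (scaleV (a - f x) u) \<in> H" using sub V.subspace_scale by blast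
    then show False using u \<open>a \<noteq> f x\<close> by simp
  qed
  have f_add: "f (x + y) = f x + f y" for x y
    using V.subspace_add[OF sub f[of x] f[of y]]
    by (intro f_unique[symmetric]) (simp add: V.scale_left_distrib algebra_simps)
  have f_scale: "f (scaleV a x) = a * f x" for a x
    using V.subspace_scale[OF sub f[of x], of a]
    by (intro f_unique[symmetric]) (simp add: V.scale_right_diff_distrib)
  obtain w where w: "\<And>x. pair x w = f x"
    using functional_representable[of f] f_add f_scale by blast
  define v where "v = u - s u"
  define \<zeta> where "\<zeta> = 1 - pair v w"
  have s_eq: "s = reflect v w"
  proof
    fix x
    have "s (x - scaleV (f x) u) = x - scaleV (f x) u" using f by (simp add: H_def)
    then show "s x = reflect v w x"
      by (simp add: reflect_def v_def w s.diff s.scale V.scale_right_diff_distrib algebra_simps)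
  qed
  have pvw: "pair v w = 1 - \<zeta>" by (simp add: \<zeta>_def)
  have "v \<noteq> 0" using u by (simp add: v_def H_def)
  have fu: "pair u w = 1" using f_unique[of u 1] w V.subspace_0[OF sub] by simp
  \<comment> \<open>Finite order is evaluated at \<open>u\<close>, whose pairing with
    \<open>w\<close> is 1. The vanishing geometric sum then excludes \<zeta> = 1, where it would be
    \<open>n\<close>, nonzero in characteristic 0, and gives \<zeta>^n = 1.\<close>
  have sum0: "(\<Sum>i<n. \<zeta> ^ i) = 0"
    using reflect_power[OF pvw, of n u] s(3) \<open>v \<noteq> 0\<close> by (simp add: s_eq fu)
  have "\<zeta> \<noteq> 1" using sum0 s(2) by auto
  moreover have "\<zeta> ^ n = 1" using one_diff_power_eq[of \<zeta> n] sum0 by simp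
  ultimately show ?thesis using that s_eq pvw s(2) by blast
qed

end

subsection \<open>Finiteness of the reflection group\<close>

lemma subgroup_GL_sum_reindex:
  assumes G: "subgroup G (GL scale)" and V: "Vector_Spaces.vector_space scale" and h: "h \<in> G"
  shows "(\<Sum>g\<in>G. F (h \<circ> g)) = (\<Sum>g\<in>G. F g)"
    and "(\<Sum>g\<in>G. F (g \<circ> h)) = (\<Sum>g\<in>G. F g)"
proof -
  interpret vs: Vector_Spaces.vector_space scale by fact
  interpret group "GL scale" by (rule vs.group_GL)
  interpret G: subgroup G "GL scale" by fact
  have hi: "inv\<^bsub>GL scale\<^esub> h \<in> G" using h by simp
  have c: "inv\<^bsub>GL scale\<^esub> h \<circ> h = id" "h \<circ> inv\<^bsub>GL scale\<^esub> h = id"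
    using l_inv[of h] r_inv[of h] G.mem_carrier[OF h] by simp_all
  have m: "x \<circ> y \<in> G" if "x \<in> G" "y \<in> G" for x y using G.m_closed[OF that] by simp
  have "bij_betw (\<lambda>g. h \<circ> g) G G"
    by (rule bij_betw_byWitness[where f' = "\<lambda>g. inv\<^bsub>GL scale\<^esub> h \<circ> g"])
      (use h hi c m in \<open>auto simp flip: comp_assoc\<close>)
  then show "(\<Sum>g\<in>G. F (h \<circ> g)) = (\<Sum>g\<in>G. F g)" by (rule sum.reindex_bij_betw)
  have "bij_betw (\<lambda>g. g \<circ> h) G G"
    by (rule bij_betw_byWitness[where f' = "\<lambda>g. g \<circ> inv\<^bsub>GL scale\<^esub> h"])
      (use h hi c m in \<open>auto simp: comp_assoc\<close>)
  then show "(\<Sum>g\<in>G. F (g \<circ> h)) = (\<Sum>g\<in>G. F g)" by (rule sum.reindex_bij_betw)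
qed

section \<open>Conjugation of bijections\<close>

lemma bij_comp_inv_into: "bij g \<Longrightarrow> g \<circ> inv_into UNIV g = id" "bij g \<Longrightarrow> inv_into UNIV g \<circ> g = id"
  by (simp_all add: fun_eq_iff bij_is_inj bij_is_surj surj_f_inv_f)

definition conj_by :: "('a \<Rightarrow> 'a) \<Rightarrow> ('a \<Rightarrow> 'a) \<Rightarrow> 'a \<Rightarrow> 'a"
  where "conj_by g t = g \<circ> t \<circ> inv_into UNIV g"

lemma conj_by_id [simp]: "conj_by id t = t"
  by (simp add: conj_by_def)

lemma conj_by_comp: "bij g \<Longrightarrow> bij h \<Longrightarrow> conj_by (g \<circ> h) t = conj_by g (conj_by h t)"
  by (simp add: conj_by_def o_inv_distrib comp_assoc)

lemma conj_by_commute: "bij g \<Longrightarrow> conj_by g t \<circ> g = g \<circ> t"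
  by (simp add: conj_by_def comp_assoc bij_comp_inv_into)

lemma conj_by_eqI: "bij g \<Longrightarrow> g \<circ> t = u \<circ> g \<Longrightarrow> conj_by g t = u"
  by (simp add: conj_by_def comp_assoc bij_comp_inv_into)

text \<open>The common setting of both directions: \<open>T\<close> is the set of root reflections
  in the first and the set of all reflections of the given group in the second. The ranges of
  \<open>1 - t\<close> are the root lines, so \<open>span_T\<close> says that these span
  \<open>V\<close>.\<close>

locale reflection_family = hermitian_pairing emb scaleV scaleW pair
  for emb :: "'k::field_char_0 \<Rightarrow> complex"
    and scaleV :: "'k \<Rightarrow> 'v::ab_group_add \<Rightarrow> 'v"
    and scaleW :: "'k \<Rightarrow> 'w::ab_group_add \<Rightarrow> 'w"
    and pair :: "'v \<Rightarrow> 'w \<Rightarrow> 'k" +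
  fixes T :: "('v \<Rightarrow> 'v) set"
  assumes finite_T: "finite T"
    and reflection_T: "t \<in> T \<Longrightarrow> is_reflection scaleV t"
    and conj_T: "s \<in> T \<Longrightarrow> t \<in> T \<Longrightarrow> \<exists>u\<in>T. s \<circ> t = u \<circ> s"
    and span_T: "V.span (\<Union>t\<in>T. range (\<lambda>x. x - t x)) = UNIV"
begin

abbreviation "G \<equiv> generate (GL scaleV) T"

lemma T_carrier: "T \<subseteq> carrier (GL scaleV)"
  using reflection_T unfolding is_reflection_def by blast

lemma subgroup_G: "subgroup G (GL scaleV)"
  by (rule group.generate_is_subgroup[OF V.group_GL T_carrier])

lemma G_linear: "g \<in> G \<Longrightarrow> Vector_Spaces.linear scaleV scaleV g"
  and G_bij: "g \<in> G \<Longrightarrow> bij g"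
  using group.generate_in_carrier[OF V.group_GL T_carrier] by simp_all

lemma G_add: "g \<in> G \<Longrightarrow> g (x + y) = g x + g y"
  and G_scale: "g \<in> G \<Longrightarrow> g (scaleV a x) = scaleV a (g x)"
  and G_0: "g \<in> G \<Longrightarrow> g 0 = 0"
proof -
  assume "g \<in> G"
  then interpret g: Vector_Spaces.linear scaleV scaleV g by (rule G_linear)
  show "g (x + y) = g x + g y" "g (scaleV a x) = scaleV a (g x)" "g 0 = 0"
    by (rule g.add g.scale g.zero)+
qed

lemma G_id: "id \<in> G"
  and G_comp: "g \<in> G \<Longrightarrow> h \<in> G \<Longrightarrow> g \<circ> h \<in> G"
  and G_inv: "g \<in> G \<Longrightarrow> inv_into UNIV g \<in> G"
proof -
  show "id \<in> G"
    using subgroup.one_closed[OF subgroup_G] unfolding GL_simps .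
  show "g \<circ> h \<in> G" if "g \<in> G" "h \<in> G"
    using subgroup.m_closed[OF subgroup_G that] unfolding GL_simps .
  show "inv_into UNIV g \<in> G" if "g \<in> G"
    using subgroup.m_inv_closed[OF subgroup_G that] V.inv_GL subgroup.mem_carrier[OF subgroup_G that] by simp
qed

lemma G_induct [consumes 1, case_names id incl inv comp]:
  assumes "g \<in> G" "P id" "\<And>t. t \<in> T \<Longrightarrow> P t" "\<And>t. t \<in> T \<Longrightarrow> P (inv_into UNIV t)"
    "\<And>g h. g \<in> G \<Longrightarrow> h \<in> G \<Longrightarrow> P g \<Longrightarrow> P h \<Longrightarrow> P (g \<circ> h)"
  shows "P g"
  using assms(1)
proof induction
  case (inv h)
  then show ?case using assms(4) V.inv_GL T_carrier by (metis subsetD)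
qed (use assms(2,3,5) in \<open>unfold GL_simps\<close>)

text \<open>\<open>conj_T\<close> covers conjugation by generators only. For their inverses,
  conjugation by \<open>s\<close> is an injective self-map of the finite set \<open>T\<close>, hence
  surjective.\<close>

lemma conj_by_T: "g \<in> G \<Longrightarrow> t \<in> T \<Longrightarrow> conj_by g t \<in> T"
proof (induction arbitrary: t rule: G_induct)
  case id
  then show ?case unfolding conj_by_id .
next
  case (incl s)
  then obtain u where "u \<in> T" "s \<circ> t = u \<circ> s" using conj_T by blast
  then show ?case using conj_by_eqI G_bij[OF generate.incl[OF incl(1)]] by metis
next
  case (inv s)
  have s: "bij s" using G_bij[OF generate.incl[OF inv(1)]] .
  have "inj_on (conj_by s) T"
  proof (rule inj_onI)
    fix t u assume "conj_by s t = conj_by s u"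
    then have "s \<circ> t = s \<circ> u"
      using conj_by_commute[OF s] by metis
    then have "inv_into UNIV s \<circ> s \<circ> t = inv_into UNIV s \<circ> s \<circ> u"
      by (metis comp_assoc)
    then show "t = u" unfolding bij_comp_inv_into(2)[OF s] by simp
  qed
  moreover have "conj_by s ` T \<subseteq> T"
  proof (rule image_subsetI)
    fix t assume "t \<in> T"
    then obtain u where "u \<in> T" "s \<circ> t = u \<circ> s" using conj_T inv(1) by blast
    then show "conj_by s t \<in> T" using conj_by_eqI[OF s] by metis
  qed
  ultimately have "conj_by s ` T = T" using finite_T by (simp add: endo_inj_surj)
  then obtain u where u: "u \<in> T" "t = conj_by s u" using inv by blast
  have "conj_by (inv_into UNIV s \<circ> s) u = u"
    unfolding bij_comp_inv_into(2)[OF s] by simp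
  then show ?case using u conj_by_comp[OF bij_imp_bij_inv[OF s] s] by metis
next
  case (comp g h)
  then show ?case using conj_by_comp[OF G_bij G_bij] by metis
qed

lemma G_conj_by_commute: "g \<in> G \<Longrightarrow> conj_by g t \<circ> g = g \<circ> t"
  by (simp add: conj_by_commute G_bij)

section \<open>Root lines and the monomial action of the group on them\<close>

definition root_vec :: "('v \<Rightarrow> 'v) \<Rightarrow> 'v"
  where "root_vec t = (SOME v. \<exists>w. t = reflect v w \<and> pair v w \<noteq> 0)"

lemma root_vec:
  assumes "t \<in> T"
  obtains w where "t = reflect (root_vec t) w" "pair (root_vec t) w \<noteq> 0" 
proof -
  obtain v w where "t = reflect v w" "pair v w \<noteq> 0"
    using is_reflection_imp_reflect[OF reflection_T[OF assms]] by (metis diff_eq_diff_eq diff_0_right diff_self)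
  then have "\<exists>v w. t = reflect v w \<and> pair v w \<noteq> 0" by blast
  from someI_ex[OF this] show ?thesis using that by (auto simp: root_vec_def)
qed

lemma root_vec_nonzero: "t \<in> T \<Longrightarrow> root_vec t \<noteq> 0"
  by (metis root_vec pair_0_left)

lemma span_root_vec: "V.span (root_vec ` T) = UNIV"
proof -
  have "x - t x \<in> V.span (root_vec ` T)" if "t \<in> T" for x t
  proof -
    obtain w where "t = reflect (root_vec t) w" using root_vec[OF \<open>t \<in> T\<close>] by blast
    then have "x - t x = scaleV (pair x w) (root_vec t)"
      using reflect_def[of "root_vec t" w x] by simp
    then show ?thesis using that by (simp add: V.span_base V.span_scale)
  qed
  then have "(\<Union>t\<in>T. range (\<lambda>x. x - t x)) \<subseteq> V.span (root_vec ` T)" by blast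
  then show ?thesis using V.span_minimal[OF _ V.subspace_span] span_T by blast
qed

text \<open>The conjugate of \<open>t\<close> by \<open>g\<close> is a reflection along
  \<open>g (root_vec t)\<close>, and a reflection determines its root line.\<close>

lemma root_vec_conj:
  assumes "g \<in> G" "t \<in> T"
  shows "\<exists>c. c \<noteq> 0 \<and> g (root_vec t) = scaleV c (root_vec (conj_by g t))"
proof -
  have g: "g \<in> carrier (GL scaleV)" using assms G_linear G_bij by simp
  obtain w where w: "t = reflect (root_vec t) w" "pair (root_vec t) w \<noteq> 0"
    using root_vec[OF assms(2)] .
  obtain w' where w': "conj_by g t = reflect (root_vec (conj_by g t)) w'"
    using root_vec[OF conj_by_T[OF assms]] .
  have "g \<circ> t = reflect (g (root_vec t)) (dual g w) \<circ> g"
    using reflect_conjugate[OF g, of "root_vec t" w] w(1) by simp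
  then have "reflect (g (root_vec t)) (dual g w) = reflect (root_vec (conj_by g t)) w'"
    using conj_by_eqI[OF G_bij[OF assms(1)]] w' by metis
  moreover have "pair (g (root_vec t)) (dual g w) \<noteq> 0" using w(2) pair_dual[OF g] by simp
  ultimately show ?thesis by (metis reflect_eqD)
qed

text \<open>The monomial coefficient of \<open>g\<close> from the line of \<open>t\<close> to that
  of its conjugate, relative to the chosen root vectors. These are nonzero, so the scalar is
  unique.\<close>

definition coeff_on :: "('v \<Rightarrow> 'v) \<Rightarrow> ('v \<Rightarrow> 'v) \<Rightarrow> 'k"
  where "coeff_on g t = (SOME c. c \<noteq> 0 \<and> g (root_vec t) = scaleV c (root_vec (conj_by g t)))"

lemma coeff_on:
  assumes "g \<in> G" "t \<in> T"
  shows "coeff_on g t \<noteq> 0" "g (root_vec t) = scaleV (coeff_on g t) (root_vec (conj_by g t))"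
  using someI_ex[OF root_vec_conj[OF assms]] by (auto simp: coeff_on_def)

lemma coeff_on_eqI:
  assumes "g \<in> G" "t \<in> T" "g (root_vec t) = scaleV c (root_vec (conj_by g t))"
  shows "coeff_on g t = c"
  using coeff_on(2)[OF assms(1,2)] assms(3) root_vec_nonzero[OF conj_by_T[OF assms(1,2)]] by simp

lemma coeff_on_id: "t \<in> T \<Longrightarrow> coeff_on id t = 1"
  by (rule coeff_on_eqI) (simp_all add: G_id)

text \<open>A cocycle rule: \<open>h\<close> first moves the line of \<open>t\<close>, and
  \<open>g\<close> acts on the moved line.\<close>

lemma coeff_on_comp:
  assumes "g \<in> G" "h \<in> G" "t \<in> T"
  shows "coeff_on (g \<circ> h) t = coeff_on g (conj_by h t) * coeff_on h t"
proof (rule coeff_on_eqI)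
  interpret g: Vector_Spaces.linear scaleV scaleV g using G_linear assms by blast
  show "(g \<circ> h) (root_vec t) = scaleV (coeff_on g (conj_by h t) * coeff_on h t) (root_vec (conj_by (g \<circ> h) t))"
    using coeff_on(2)[OF assms(2,3)] coeff_on(2)[OF assms(1) conj_by_T[OF assms(2,3)]] assms
    by (simp add: g.scale conj_by_comp G_bij mult.commute)
qed (use assms G_comp in auto)

definition orbit :: "('v \<Rightarrow> 'v) \<Rightarrow> ('v \<Rightarrow> 'v) set"
  where "orbit t = (\<lambda>g. conj_by g t) ` G"

lemma orbit_subset: "t \<in> T \<Longrightarrow> orbit t \<subseteq> T"
  by (auto simp: orbit_def conj_by_T)

lemma conj_by_inv: "g \<in> G \<Longrightarrow> conj_by (inv_into UNIV g) (conj_by g t) = t"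
  and conj_by_inv': "g \<in> G \<Longrightarrow> conj_by g (conj_by (inv_into UNIV g) t) = t"
  by (metis G_bij G_inv bij_comp_inv_into conj_by_comp conj_by_id)+

lemma bij_betw_orbit:
  assumes "h \<in> G"
  shows "bij_betw (conj_by h) (orbit t) (orbit t)"
proof -
  have "conj_by g ` orbit t \<subseteq> orbit t" if "g \<in> G" for g
    using that by (auto simp: orbit_def G_bij G_comp simp flip: conj_by_comp)
  then show ?thesis
    using assms by (intro bij_betw_byWitness[where f' = "conj_by (inv_into UNIV h)"])
      (auto simp: conj_by_inv conj_by_inv' G_inv)
qed

text \<open>The determinant of the monomial action of \<open>G\<close> on the lines of an orbit, up to sign.\<close>

definition monomial_det :: "('v \<Rightarrow> 'v) \<Rightarrow> ('v \<Rightarrow> 'v) \<Rightarrow> 'k"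
  where "monomial_det t g = (\<Prod>u\<in>orbit t. coeff_on g u)"

lemma monomial_det_id: "t \<in> T \<Longrightarrow> monomial_det t id = 1"
  using orbit_subset coeff_on_id by (auto simp: monomial_det_def intro!: prod.neutral)

text \<open>Take the product of the cocycle rule over the class; conjugation by \<open>h\<close>
  permutes the class, which removes the twist.\<close>

lemma monomial_det_comp:
  assumes "g \<in> G" "h \<in> G" "t \<in> T"
  shows "monomial_det t (g \<circ> h) = monomial_det t g * monomial_det t h"
proof -
  have "monomial_det t (g \<circ> h) = (\<Prod>u\<in>orbit t. coeff_on g (conj_by h u) * coeff_on h u)"
    unfolding monomial_det_def
    using coeff_on_comp[OF assms(1,2)] orbit_subset[OF assms(3)] by (intro prod.cong) auto
  also have "\<dots> = monomial_det t g * monomial_det t h"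
    unfolding monomial_det_def prod.distrib
    using prod.reindex_bij_betw[OF bij_betw_orbit[OF assms(2)], of "coeff_on g"] by simp
  finally show ?thesis .
qed

lemma G_power: "g \<in> G \<Longrightarrow> g ^^ n \<in> G"
  by (induction n) (auto intro: G_id G_comp)

lemma common_exponent: "\<exists>N>0. \<forall>s\<in>T. s ^^ N = id"
proof -
  have "\<exists>N>0. \<forall>s\<in>S. s ^^ N = id" if "S \<subseteq> T" for S
    using finite_subset[OF that finite_T] that
  proof (induction S rule: finite_induct)
    case (insert s S)
    then obtain N where N: "N > 0" "\<forall>s\<in>S. s ^^ N = id" by blast
    obtain n where n: "n > 0" "s ^^ n = id"
      using reflection_T insert.prems unfolding is_reflection_def by blast
    have mult: "r ^^ (a * b) = id" if "r ^^ a = id" for r :: "'v \<Rightarrow> 'v" and a b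
      using that by (induction b) (simp_all add: funpow_add)
    show ?case
      using N n mult[where a = N and b = n] mult[where a = n and b = N and r = s]
      by (intro exI[of _ "N * n"]) (auto simp: mult.commute)
  qed auto
  then show ?thesis by blast
qed

text \<open>The determinant is multiplicative with commutative values, so checking its
  \<open>N\<close>-th power on the generators suffices even before \<open>G\<close> is known to be
  finite.\<close>

lemma monomial_det_root_of_unity:
  assumes N: "\<forall>s\<in>T. s ^^ N = id" and t: "t \<in> T" and g: "g \<in> G"
  shows "monomial_det t g ^ N = 1"
proof -
  have incl: "monomial_det t s ^ N = 1" if "s \<in> T" for s
  proof -
    have s: "s \<in> G" using that by (rule generate.incl)
    have "monomial_det t (s ^^ n) = monomial_det t s ^ n" for n
    proof (induction n)
      case 0
      show ?case unfolding funpow.simps monomial_det_id[OF t] by (rule power_0[symmetric])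
    next
      case (Suc n)
      then show ?case using monomial_det_comp[OF s G_power[OF s] t, of n] by (simp only: funpow.simps power_Suc)
    qed
    then show ?thesis using N that monomial_det_id[OF t] by metis
  qed
  show ?thesis
    using g
  proof (induction rule: G_induct)
    case id
    show ?case unfolding monomial_det_id[OF t] by (rule power_one)
  next
    case (comp g h)
    then show ?case using monomial_det_comp[OF comp(1,2) t] by (simp only: power_mult_distrib mult_1)
  next
    case (inv s)
    have s: "s \<in> G" using inv by (rule generate.incl)
    have "monomial_det t (inv_into UNIV s \<circ> s) = 1"
      unfolding bij_comp_inv_into(2)[OF G_bij[OF s]] by (rule monomial_det_id[OF t])
    then have "monomial_det t (inv_into UNIV s) * monomial_det t s = 1"
      using monomial_det_comp s G_inv t by simp
    then show ?case using incl[OF inv] by (metis mult.right_neutral power_mult_distrib power_one)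
  qed (rule incl)
qed

text \<open>Introduced as the kernel of conjugation on \<open>T\<close>; it is the centre because
  \<open>T\<close> generates \<open>G\<close>.\<close>

definition centre :: "('v \<Rightarrow> 'v) set"
  where "centre = {z \<in> G. \<forall>t\<in>T. conj_by z t = t}"

lemma centre_commute:
  assumes "z \<in> centre" "g \<in> G"
  shows "z \<circ> g = g \<circ> z"
  using assms(2)
proof (induction rule: G_induct)
  case (incl t)
  then show ?case using assms(1) G_conj_by_commute[of z t] by (simp add: centre_def)
next
  case (inv t)
  have "z \<circ> t = t \<circ> z" using inv assms(1) G_conj_by_commute[of z t] by (simp add: centre_def)
  moreover have t: "bij t" using inv G_bij generate.incl by metis
  ultimately have "inv_into UNIV t \<circ> (z \<circ> t) \<circ> inv_into UNIV t = inv_into UNIV t \<circ> (t \<circ> z) \<circ> inv_into UNIV t"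
    by simp
  then show ?case
    using bij_comp_inv_into[OF t] by (metis comp_assoc comp_id id_comp)
next
  case (comp g h)
  then show ?case by (metis comp_assoc)
qed simp

text \<open>Central elements act on the lines of an orbit by a single scalar, a power of which
  is the monomial determinant.\<close>

lemma centre_coeff_root_of_unity:
  assumes N: "\<forall>s\<in>T. s ^^ N = id" and t: "t \<in> T" and z: "z \<in> centre"
  shows "coeff_on z t ^ (card (orbit t) * N) = 1"
proof -
  have zG: "z \<in> G" using z by (simp add: centre_def)
  have "coeff_on z u = coeff_on z t" if "u \<in> orbit t" for u
  proof -
    obtain g where g: "g \<in> G" "u = conj_by g t" using \<open>u \<in> orbit t\<close> unfolding orbit_def by blast
    \<comment> \<open>Compute the coefficient of \<open>z g = g z\<close> at \<open>t\<close> in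
      both orders and cancel that of \<open>g\<close>.\<close>
    have "coeff_on z u * coeff_on g t = coeff_on (z \<circ> g) t" using coeff_on_comp zG g t by simp
    also have "z \<circ> g = g \<circ> z" by (rule centre_commute[OF z g(1)])
    also have "coeff_on (g \<circ> z) t = coeff_on g t * coeff_on z t"
      using coeff_on_comp zG g(1) t z by (simp add: centre_def)
    finally show ?thesis using coeff_on(1)[OF g(1) t] by simp
  qed
  then have "monomial_det t z = coeff_on z t ^ card (orbit t)"
    by (simp add: monomial_det_def)
  then show ?thesis using monomial_det_root_of_unity[OF N t zG] by (simp add: power_mult)
qed

text \<open>The root vectors span \<open>V\<close>, so a central element is determined by its
  scalars on them, and each scalar ranges over a finite set of roots of unity.\<close>

lemma finite_centre: "finite centre"
proof -
  obtain N where N: "N > 0" "\<forall>s\<in>T. s ^^ N = id" using common_exponent by blast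
  define m where "m t = card (orbit t) * N" for t
  have m: "m t > 0" if "t \<in> T" for t
  proof -
    have "finite (orbit t)" using orbit_subset[OF that] finite_T finite_subset by blast
    moreover have "orbit t \<noteq> {}" using G_id by (auto simp: orbit_def)
    ultimately show ?thesis using N(1) by (simp add: m_def card_gt_0_iff)
  qed
  let ?\<Phi> = "\<lambda>z. restrict (coeff_on z) T"
  have "?\<Phi> ` centre \<subseteq> PiE T (\<lambda>t. {c. c ^ m t = 1})"
    using centre_coeff_root_of_unity[OF N(2)] by (auto simp: m_def)
  moreover have "finite (PiE T (\<lambda>t. {c::'k. c ^ m t = 1}))"
    using finite_T m finite_roots_of_unity by (intro finite_PiE) auto
  ultimately have "finite (?\<Phi> ` centre)" by (rule finite_subset)
  moreover have "inj_on ?\<Phi> centre"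
  proof (rule inj_onI)
    fix y z assume yz: "y \<in> centre" "z \<in> centre" "?\<Phi> y = ?\<Phi> z"
    then have G: "y \<in> G" "z \<in> G" by (auto simp: centre_def)
    interpret VV: Vector_Spaces.vector_space_pair scaleV scaleV ..
    have "y x = z x" if "x \<in> root_vec ` T" for x
    proof -
      obtain t where t: "t \<in> T" "x = root_vec t" using \<open>x \<in> root_vec ` T\<close> by blast
      have "coeff_on y t = coeff_on z t" using t(1) yz(3) by (metis restrict_apply')
      then show ?thesis
        using coeff_on(2)[OF G(1) t(1)] coeff_on(2)[OF G(2) t(1)] yz(1,2) t by (simp add: centre_def)
    qed
    then show "y = z"
      using VV.linear_eq_on[OF G_linear[OF G(1)] G_linear[OF G(2)], of _ "root_vec ` T"] span_root_vec
      by blast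
  qed
  ultimately show ?thesis by (rule finite_imageD)
qed

text \<open>Conjugation on \<open>T\<close> takes finitely many values, and elements of
  \<open>G\<close> with the same action differ by a central element.\<close>

lemma finite_G: "finite G"
proof -
  let ?\<phi> = "\<lambda>g. restrict (conj_by g) T"
  have "?\<phi> ` G \<subseteq> PiE T (\<lambda>_. T)" by (auto simp: conj_by_T)
  moreover have "finite (PiE T (\<lambda>_. T))" using finite_T by (intro finite_PiE) auto
  ultimately have fin: "finite (?\<phi> ` G)" by (rule finite_subset)
  have fibre: "finite {g \<in> G. ?\<phi> g = ?\<phi> h}" if h: "h \<in> G" for h
  proof (rule finite_subset)
    show "{g \<in> G. ?\<phi> g = ?\<phi> h} \<subseteq> (\<lambda>z. h \<circ> z) ` centre"
    proof
      fix g assume "g \<in> {g \<in> G. ?\<phi> g = ?\<phi> h}"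
      then have g: "g \<in> G" "?\<phi> g = ?\<phi> h" by auto
      let ?z = "inv_into UNIV h \<circ> g"
      have "conj_by ?z t = t" if "t \<in> T" for t
      proof -
        have "conj_by g t = conj_by h t" using g(2) that by (metis restrict_apply')
        then show ?thesis
          using conj_by_comp[OF G_bij[OF G_inv[OF h]] G_bij[OF g(1)]] conj_by_inv[OF h] by simp
      qed
      then have "?z \<in> centre" using g h G_inv G_comp by (simp add: centre_def)
      moreover have "g = h \<circ> ?z"
        by (metis G_bij[OF h] bij_comp_inv_into(1) comp_assoc id_comp)
      ultimately show "g \<in> (\<lambda>z. h \<circ> z) ` centre" by blast
    qed
  qed (simp add: finite_centre)
  have "G \<subseteq> (\<Union>p\<in>?\<phi> ` G. {g \<in> G. ?\<phi> g = p})" by blast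
  moreover have "finite (\<Union>p\<in>?\<phi> ` G. {g \<in> G. ?\<phi> g = p})"
  proof (rule finite_UN_I[OF fin])
    show "finite {g \<in> G. ?\<phi> g = p}" if "p \<in> ?\<phi> ` G" for p
      using that fibre by blast
  qed
  ultimately show ?thesis by (rule finite_subset)
qed

text \<open>The sum \<open>p\<close> over the group kills every \<open>x - t x\<close>, hence all of
  \<open>V\<close>, yet multiplies a fixed vector by the group order, which is nonzero in
  characteristic 0.\<close>

lemma fixed_space_G: "fixed_space G = {0}"
proof -
  define p where "p x = (\<Sum>g\<in>G. g x)" for x
  interpret p: Vector_Spaces.linear scaleV scaleV p
  proof unfold_locales
    show "p (x + y) = p x + p y" for x y
      unfolding p_def sum.distrib[symmetric]
      by (intro sum.cong refl G_add)
    show "p (scaleV a x) = scaleV a (p x)" for a x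
      unfolding p_def V.scale_sum_right
      by (intro sum.cong refl G_scale)
  qed
  have "p x = 0" if "x \<in> V.span (\<Union>t\<in>T. range (\<lambda>x. x - t x))" for x
  proof (rule p.eq_0_on_span[OF _ that])
    fix y assume "y \<in> (\<Union>t\<in>T. range (\<lambda>x. x - t x))"
    then obtain t x where t: "t \<in> T" "y = x - t x" by blast
    have "p (t x) = p x"
      using subgroup_GL_sum_reindex(2)[OF subgroup_G V.vector_space_axioms generate.incl[OF t(1)], of "\<lambda>g. g x"]
      unfolding p_def comp_apply .
    then show "p y = 0" unfolding t(2) p.diff by simp
  qed
  then have p0: "p x = 0" for x using span_T by blast
  have "x = 0" if "\<And>g. g \<in> G \<Longrightarrow> g x = x" for x
  proof -
    have "p x = scaleV (of_nat (card G)) x"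
      unfolding p_def V.sum_constant_scale[symmetric] by (rule sum.cong[OF refl that])
    moreover have "card G \<noteq> 0" using finite_G G_id by (auto simp: card_eq_0_iff)
    ultimately show ?thesis using p0[of x] by simp
  qed
  then show ?thesis using G_0 unfolding fixed_space_def by blast
qed

theorem essential_finite_reflection_group_G: "essential_finite_reflection_group scaleV G"
  unfolding essential_finite_reflection_group_def finite_reflection_group_def
  using subgroup_G finite_G fixed_space_G reflection_T by blast

end

subsection \<open>Reflection families\<close>

lemma (in Vector_Spaces.vector_space) dim_1E:
  assumes "dim I = 1"
  obtains b where "span I = span {b}"
proof -
  obtain B where B: "B \<subseteq> I" "I \<subseteq> span B" "card B = 1"
    using basis_exists[of I] assms by metis
  then obtain b where "B = {b}" by (auto simp: card_1_singleton_iff)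
  then have "span I = span {b}"
    using B span_eq by (metis span_superset order_trans)
  then show ?thesis by (rule that)
qed

section \<open>Reflections attached to roots, and the two sources of reflection families\<close>

context hermitian_pairing
begin

lemma reflect_pair_unique:
  assumes "reflect v w = reflect v' w'" "pair v w \<noteq> 0"
  shows "pair v w = pair v' w'"
proof -
  obtain c where c: "c \<noteq> 0" "v = scaleV c v'" using reflect_eqD[OF assms] .
  have "scaleV (pair v w) v = scaleV (pair v w') v'"
    using fun_cong[OF assms(1), of v] by (simp add: reflect_def)
  then have "scaleV (pair v w * c) v' = scaleV (c * pair v' w') v'"
    using c(2) by (simp add: pair_scale_left)
  moreover have "v' \<noteq> 0" using c(2) assms(2) by auto
  ultimately have "pair v w * c = c * pair v' w'" by (simp only: V.scale_cancel_right) simp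
  then show ?thesis using c(1) by simp
qed

text \<open>On fixed lines the map depends only on the product of the coefficient of
  \<open>v\<close> with the conjugated coefficient of \<open>w\<close>, and the value of the pairing
  determines this product.\<close>

lemma reflect_cong_lines:
  assumes "pair v w = c" "pair v' w' = c" "c \<noteq> 0"
    and "V.dim I = 1" "v \<in> V.span I" "v' \<in> V.span I"
    and "W.dim J = 1" "w \<in> W.span J" "w' \<in> W.span J"
  shows "reflect v' w' = reflect v w"
proof -
  obtain b where b: "V.span I = V.span {b}" using V.dim_1E[OF assms(4)] .
  obtain d where d: "W.span J = W.span {d}" using W.dim_1E[OF assms(7)] .
  obtain p p' where p: "v = scaleV p b" "v' = scaleV p' b"
    using assms(5,6) unfolding b V.span_singleton by blast
  obtain q q' where q: "w = scaleW q d" "w' = scaleW q' d"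
    using assms(8,9) unfolding d W.span_singleton by blast
  have "p * k_conj q * pair b d = p' * k_conj q' * pair b d" "pair b d \<noteq> 0"
    using assms(1-3) by (auto simp: p q pair_scale_left pair_scale_right mult_ac)
  then have "p * k_conj q = p' * k_conj q'" by simp
  then show ?thesis
    by (intro ext) (simp add: reflect_def p q pair_scale_right, metis mult.assoc mult.commute)
qed

lemma Zk_submodule_0: "Zk_submodule (*) {0}"
  by (simp add: Zk_submodule_def)

lemma Zk_submodule_multiples: "Zk_submodule (*) {c * a |a. algebraic_int a}" for c :: 'k
  unfolding Zk_submodule_def
proof (intro conjI ballI allI impI)
  show "0 \<in> {c * a |a. algebraic_int a}" by (auto intro!: exI[of _ 0])
  show "x + y \<in> {c * a |a. algebraic_int a}"
    if "x \<in> {c * a |a. algebraic_int a}" "y \<in> {c * a |a. algebraic_int a}" for x y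
    using that by (auto intro!: algebraic_int_add simp flip: distrib_left)
  show "a * x \<in> {c * a |a. algebraic_int a}"
    if "algebraic_int a" "x \<in> {c * a |a. algebraic_int a}" for a x
  proof -
    obtain b where "x = c * b" "algebraic_int b" using \<open>x \<in> _\<close> by blast
    then have "a * x = c * (a * b)" "algebraic_int (a * b)"
      using algebraic_int_mult \<open>algebraic_int a\<close> by (simp_all add: mult.left_commute)
    then show ?thesis by blast
  qed
qed

text \<open>The ideal of the root contains the nonzero element 1 - \<zeta>, so some pairing between
  \<open>I\<close> and \<open>J\<close> is nonzero; rescaling on the right gives the required
  value.\<close>

lemma is_root_reflect:
  assumes "is_root (I, J, \<zeta>)"
  obtains v w where "v \<in> V.span I" "w \<in> W.span J" "pair v w = 1 - \<zeta>"
proof -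
  have r: "\<zeta> \<noteq> 1" "pair_ideal I J = {(1 - \<zeta>) * a | a. algebraic_int a}"
    using assms unfolding is_root_def by auto
  have "\<exists>\<alpha>\<in>I. \<exists>\<beta>\<in>J. pair \<alpha> \<beta> \<noteq> 0"
  proof (rule ccontr)
    assume "\<not> ?thesis"
    then have "pair_ideal I J \<subseteq> {0}"
      unfolding pair_ideal_def by (intro Zk_span_minimal Zk_submodule_0) auto
    moreover have "(1 - \<zeta>) * 1 \<in> pair_ideal I J" unfolding r(2) by blast
    ultimately show False using r(1) by auto
  qed
  then obtain \<alpha> \<beta> where ab: "\<alpha> \<in> I" "\<beta> \<in> J" "pair \<alpha> \<beta> \<noteq> 0" by blast
  show ?thesis
  proof
    show "\<alpha> \<in> V.span I" using ab by (simp add: V.span_base)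
    show "scaleW (k_conj ((1 - \<zeta>) / pair \<alpha> \<beta>)) \<beta> \<in> W.span J"
      using ab by (simp add: W.span_base W.span_scale)
    show "pair \<alpha> (scaleW (k_conj ((1 - \<zeta>) / pair \<alpha> \<beta>)) \<beta>) = 1 - \<zeta>"
      using ab by (simp add: pair_scale_right)
  qed
qed

lemma root_reflection_eq:
  assumes "is_root (I, J, \<zeta>)" "v \<in> V.span I" "w \<in> W.span J" "pair v w = 1 - \<zeta>"
  shows "root_reflection (I, J, \<zeta>) = reflect v w"
proof -
  have r: "V.dim I = 1" "W.dim J = 1" "1 - \<zeta> \<noteq> 0"
    using assms(1) unfolding is_root_def by auto
  have "(THE s. \<exists>v\<in>V.span I. \<exists>w\<in>W.span J. pair v w = 1 - \<zeta> \<and> s = (\<lambda>x. x - scaleV (pair x w) v))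
      = reflect v w"
  proof (rule the_equality)
    show "\<exists>v'\<in>V.span I. \<exists>w'\<in>W.span J. pair v' w' = 1 - \<zeta> \<and> reflect v w = (\<lambda>x. x - scaleV (pair x w') v')"
      using assms(2-4) reflect_def by (intro bexI[of _ v] bexI[of _ w]) (auto intro!: ext)
    fix s assume "\<exists>v'\<in>V.span I. \<exists>w'\<in>W.span J. pair v' w' = 1 - \<zeta> \<and> s = (\<lambda>x. x - scaleV (pair x w') v')"
    then obtain v' w' where s: "v' \<in> V.span I" "w' \<in> W.span J" "pair v' w' = 1 - \<zeta>"
      "s = (\<lambda>x. x - scaleV (pair x w') v')" by blast
    have "s = reflect v' w'" unfolding s(4) by (rule ext) (simp add: reflect_def)
    also have "\<dots> = reflect v w"
      by (rule reflect_cong_lines[OF assms(4) s(3) r(3) r(1) assms(2) s(1) r(2) assms(3) s(2)])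
    finally show "s = reflect v w" .
  qed
  then show ?thesis unfolding root_reflection_def by simp
qed

lemma is_root_imp_is_reflection:
  assumes "is_root r"
  shows "is_reflection scaleV (root_reflection r)"
proof -
  obtain I J \<zeta> where r: "r = (I, J, \<zeta>)" by (cases r)
  obtain v w where vw: "v \<in> V.span I" "w \<in> W.span J" "pair v w = 1 - \<zeta>"
    using is_root_reflect assms unfolding r by blast
  obtain n where "\<zeta> \<noteq> 1" "n > 0" "\<zeta> ^ n = 1" using assms unfolding r is_root_def by auto
  then show ?thesis
    using root_reflection_eq[OF assms[unfolded r] vw] is_reflection_reflect[OF vw(3)] unfolding r by simp
qed

lemma root_reflection_action:
  assumes "is_root r" "is_root (root_action g r)" and g: "g \<in> carrier (GL scaleV)"
  shows "g \<circ> root_reflection r = root_reflection (root_action g r) \<circ> g"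
proof -
  obtain I J \<zeta> where r: "r = (I, J, \<zeta>)" by (cases r)
  have gr: "root_action g r = (g ` I, dual g ` J, \<zeta>)" by (simp add: r root_action_def)
  obtain v w where vw: "v \<in> V.span I" "w \<in> W.span J" "pair v w = 1 - \<zeta>"
    using is_root_reflect assms(1) unfolding r by blast
  interpret g: Vector_Spaces.linear scaleV scaleV g using g by simp
  interpret d: Vector_Spaces.linear scaleW scaleW "dual g" using dual_in_GL[OF g] by simp
  have "root_reflection (root_action g r) = reflect (g v) (dual g w)"
    unfolding gr
  proof (rule root_reflection_eq)
    show "is_root (g ` I, dual g ` J, \<zeta>)" using assms(2) by (simp add: gr)
    show "g v \<in> V.span (g ` I)" using vw(1) g.span_image by blast
    show "dual g w \<in> W.span (dual g ` J)" using vw(2) d.span_image by blast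
    show "pair (g v) (dual g w) = 1 - \<zeta>" using vw(3) pair_dual[OF g] by simp
  qed
  then show ?thesis
    using reflect_conjugate[OF g] root_reflection_eq[OF assms(1)[unfolded r] vw] by (simp add: r)
qed

text \<open>Stability of \<open>R\<close> under its reflections becomes stability of the reflections
  under conjugation, and each \<open>I\<close> lies on the line moved by its reflection.\<close>

lemma root_system_reflection_family:
  assumes R: "root_system R"
  shows "reflection_family emb scaleV scaleW pair (root_reflection ` R)"
proof unfold_locales
  have roots: "\<And>r. r \<in> R \<Longrightarrow> is_root r" and fin: "finite R"
    and span: "V.span (\<Union>(I, J, \<zeta>)\<in>R. I) = UNIV"
    and act: "\<And>r. r \<in> R \<Longrightarrow> root_action (root_reflection r) ` R = R"
    using R unfolding root_system_def by auto
  show "finite (root_reflection ` R)" using fin by simp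
  show "is_reflection scaleV t" if "t \<in> root_reflection ` R" for t
    using that is_root_imp_is_reflection roots by blast
  show "\<exists>u\<in>root_reflection ` R. s \<circ> t = u \<circ> s"
    if s: "s \<in> root_reflection ` R" and t: "t \<in> root_reflection ` R" for s t
  proof -
    obtain r q where rq: "r \<in> R" "s = root_reflection r" "q \<in> R" "t = root_reflection q"
      using s t by blast
    have sq: "root_action s q \<in> R" using act rq by blast
    have "s \<in> carrier (GL scaleV)"
      using is_root_imp_is_reflection[OF roots[OF rq(1)]] rq(2) unfolding is_reflection_def by simp
    then have "s \<circ> t = root_reflection (root_action s q) \<circ> s"
      using root_reflection_action roots rq(3,4) sq by blast
    then show ?thesis using sq by blast
  qed
  have "x \<in> V.span (\<Union>t\<in>root_reflection ` R. range (\<lambda>x. x - t x))"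
    if "(I, J, \<zeta>) \<in> R" and "x \<in> I" for I J \<zeta> x
  proof -
    have root: "is_root (I, J, \<zeta>)" using roots that by blast
    then have z: "\<zeta> \<noteq> 1" "V.dim I = 1" unfolding is_root_def by auto
    obtain v w where vw: "v \<in> V.span I" "w \<in> W.span J" "pair v w = 1 - \<zeta>"
      using is_root_reflect[OF root] .
    obtain b where b: "V.span I = V.span {b}" using V.dim_1E[OF z(2)] .
    obtain p q where p: "v = scaleV p b" and q: "x = scaleV q b"
      using vw(1) V.span_base[OF \<open>x \<in> I\<close>] unfolding b V.span_singleton by blast
    have "p \<noteq> 0" using p vw(3) z(1) by auto
    let ?t = "root_reflection (I, J, \<zeta>)"
    \<comment> \<open>The reflection moves \<open>v\<close> by a nonzero multiple of itself, so
      every \<open>x\<close> on its line is a multiple of \<open>v - ?t v\<close>.\<close>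
    have "x = scaleV (q / (p * (1 - \<zeta>))) (v - ?t v)"
    proof -
      have "v - ?t v = scaleV (1 - \<zeta>) v"
        using root_reflection_eq[OF root vw] by (simp add: reflect_def vw(3))
      then show ?thesis using z(1) \<open>p \<noteq> 0\<close> by (simp add: p q)
    qed
    moreover have "v - ?t v \<in> (\<Union>t\<in>root_reflection ` R. range (\<lambda>x. x - t x))" using \<open>(I, J, \<zeta>) \<in> R\<close> by blast
    ultimately show ?thesis by (metis V.span_base V.span_scale)
  qed
  then have "(\<Union>(I, J, \<zeta>)\<in>R. I) \<subseteq> V.span (\<Union>t\<in>root_reflection ` R. range (\<lambda>x. x - t x))" by blast
  then show "V.span (\<Union>t\<in>root_reflection ` R. range (\<lambda>x. x - t x)) = UNIV"
    using V.span_minimal[OF _ V.subspace_span] span by blast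
qed

text \<open>The spanning condition is where essentiality enters: modulo the span \<open>U\<close> of
  the root lines \<open>G\<close> acts trivially, so averaging puts every vector into
  \<open>U\<close> up to a fixed vector, which is 0.\<close>

lemma reflection_group_reflection_family:
  assumes G: "essential_finite_reflection_group scaleV G"
  defines "T \<equiv> {s \<in> G. is_reflection scaleV s}"
  shows "reflection_family emb scaleV scaleW pair T" "generate (GL scaleV) T = G"
proof -
  obtain S where sub: "subgroup G (GL scaleV)" and fin: "finite G"
    and S: "\<forall>s\<in>S. is_reflection scaleV s" "G = generate (GL scaleV) S" and fixed: "fixed_space G = {0}"
    using G unfolding essential_finite_reflection_group_def finite_reflection_group_def by blast
  have lin: "Vector_Spaces.linear scaleV scaleV g" and bij: "bij g" if "g \<in> G" for g
    using subgroup.mem_carrier[OF sub that] by simp_all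
  have "S \<subseteq> T" using S generate.incl[of _ S "GL scaleV"] unfolding T_def by blast
  then have "G \<subseteq> generate (GL scaleV) T"
    using group.mono_generate[OF V.group_GL] S(2) by blast
  moreover have "generate (GL scaleV) T \<subseteq> G"
    by (rule group.generate_subgroup_incl[OF V.group_GL _ sub]) (simp add: T_def)
  ultimately show gen: "generate (GL scaleV) T = G" by blast
  have id: "id \<in> G" using subgroup.one_closed[OF sub] unfolding GL_simps .
  have comp: "g \<circ> h \<in> G" if "g \<in> G" "h \<in> G" for g h
    using subgroup.m_closed[OF sub that] unfolding GL_simps .
  show "reflection_family emb scaleV scaleW pair T"
  proof unfold_locales
    show "finite T" using fin by (simp add: T_def)
    show "is_reflection scaleV t" if "t \<in> T" for t using that by (simp add: T_def)
    show "\<exists>u\<in>T. s \<circ> t = u \<circ> s" if st: "s \<in> T" "t \<in> T" for s t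
    proof -
      have s: "s \<in> G" "t \<in> G" "s \<in> carrier (GL scaleV)"
        using st subgroup.mem_carrier[OF sub] unfolding T_def by blast+
      obtain v w \<zeta> n where t: "t = reflect v w" "pair v w = 1 - \<zeta>" "\<zeta> \<noteq> 1" "\<zeta> ^ n = 1" "n > 0"
        using is_reflection_imp_reflect st(2) unfolding T_def by blast
      let ?u = "reflect (s v) (dual s w)"
      have st': "s \<circ> t = ?u \<circ> s" unfolding t(1) by (rule reflect_conjugate[OF s(3)])
      have si: "inv_into UNIV s \<in> G"
        using subgroup.m_inv_closed[OF sub s(1)] V.inv_GL[OF s(3)] by simp
      have "s \<circ> t \<circ> inv_into UNIV s = ?u"
        unfolding st' comp_assoc bij_comp_inv_into(1)[OF bij[OF s(1)]] by (rule comp_id)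
      then have "?u \<in> G" using comp[OF comp[OF s(1,2)] si] by simp
      moreover have "is_reflection scaleV ?u"
        using is_reflection_reflect[of "s v" "dual s w"] t pair_dual[OF s(3)] by simp
      ultimately show ?thesis using st' unfolding T_def by blast
    qed
    define U where "U = V.span (\<Union>t\<in>T. range (\<lambda>x. x - t x))"
    have base: "x - t x \<in> U" if "t \<in> T" for t x
      unfolding U_def using that by (intro V.span_base) blast
    \<comment> \<open>Displacements telescope along a word: \<open>x - g (h x)\<close> is
      \<open>(x - h x) + (h x - g (h x))\<close>.\<close>
    have moved: "x - g x \<in> U" if "g \<in> generate (GL scaleV) T" for g x
      using that
    proof (induction arbitrary: x)
      case one
      show ?case unfolding GL_simps U_def by (simp add: V.span_zero)
    next
      case (incl t)
      then show ?case by (rule base)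
    next
      case (inv t)
      then have t: "t \<in> carrier (GL scaleV)" using subgroup.mem_carrier[OF sub] unfolding T_def by blast
      let ?y = "inv_into UNIV t x"
      have "t ?y = x" using t by (simp add: bij_is_surj surj_f_inv_f)
      then have "x - ?y = - (?y - t ?y)" by simp
      also have "\<dots> \<in> U" using base[OF inv] unfolding U_def by (rule V.span_neg)
      finally show ?case using V.inv_GL[OF t] by simp
    next
      case (eng g h)
      have "(x - h x) + (h x - g (h x)) \<in> U"
        using eng.IH unfolding U_def by (rule V.span_add[rotated])
      then show ?case unfolding GL_simps comp_apply by simp
    qed
    have "x \<in> U" for x
    proof -
      define p where "p = (\<Sum>g\<in>G. g x)"
      have "h p = p" if h: "h \<in> G" for h
      proof -
        interpret h: Vector_Spaces.linear scaleV scaleV h by (rule lin[OF h])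
        show ?thesis
          using subgroup_GL_sum_reindex(1)[OF sub V.vector_space_axioms h, of "\<lambda>g. g x"]
          unfolding p_def h.sum comp_apply .
      qed
      then have "p \<in> fixed_space G" unfolding fixed_space_def by blast
      then have "p = 0" using fixed by blast
      have "scaleV (of_nat (card G)) x - p = (\<Sum>g\<in>G. x - g x)"
        unfolding p_def sum_subtractf V.sum_constant_scale ..
      also have "\<dots> \<in> U"
        using moved unfolding gen U_def by (rule V.span_sum)
      finally have "scaleV (of_nat (card G)) x \<in> U" using \<open>p = 0\<close> by simp
      then have "scaleV (inverse (of_nat (card G))) (scaleV (of_nat (card G)) x) \<in> U"
        unfolding U_def by (rule V.span_scale)
      moreover have "card G \<noteq> 0" using fin id by (metis card_0_eq empty_iff)
      ultimately show ?thesis by simp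
    qed
    then show "V.span (\<Union>t\<in>T. range (\<lambda>x. x - t x)) = UNIV" unfolding U_def by blast
  qed
qed

end

subsection \<open>The root system of a reflection group\<close>

lemma Zk_span_image:
  assumes add: "\<And>x y. f (x + y) = f x + f y" and zero: "f 0 = 0"
    and scale: "\<And>a x. f (s1 a x) = s2 a (f x)"
  shows "f ` Zk_span s1 S = Zk_span s2 (f ` S)"
proof
  have "Zk_submodule s1 {x. f x \<in> Zk_span s2 (f ` S)}"
    unfolding Zk_submodule_def
    by (auto simp: zero add scale Zk_span_zero Zk_span_add Zk_span_scale)
  then have "Zk_span s1 S \<subseteq> {x. f x \<in> Zk_span s2 (f ` S)}"
    by (intro Zk_span_minimal) (auto intro: Zk_span_base)
  then show "f ` Zk_span s1 S \<subseteq> Zk_span s2 (f ` S)" by blast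
  have "Zk_submodule s2 (f ` Zk_span s1 S)"
    unfolding Zk_submodule_def
  proof (intro conjI ballI allI impI)
    show "0 \<in> f ` Zk_span s1 S" using Zk_span_zero zero[symmetric] by (rule image_eqI[rotated])
    show "x + y \<in> f ` Zk_span s1 S" if "x \<in> f ` Zk_span s1 S" "y \<in> f ` Zk_span s1 S" for x y
      using that by (auto intro: Zk_span_add simp flip: add)
    show "s2 a x \<in> f ` Zk_span s1 S" if "algebraic_int a" "x \<in> f ` Zk_span s1 S" for a x
      using that by (auto intro: Zk_span_scale simp flip: scale)
  qed
  then show "Zk_span s2 (f ` S) \<subseteq> f ` Zk_span s1 S"
    by (intro Zk_span_minimal) (auto intro: Zk_span_base)
qed

lemma (in Vector_Spaces.vector_space) dim_eq_1I:
  assumes "I \<subseteq> span {v}" "x \<in> I" "x \<noteq> 0"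
  shows "dim I = 1" "span I = span {v}"
proof -
  obtain a where a: "x = scale a v" using assms(1,2) unfolding span_singleton by blast
  then have "scale (inverse a) x = v" using assms(3) by auto
  then have "v \<in> span I" using span_scale[OF span_base[OF assms(2)], of "inverse a"] by metis
  then show eq: "span I = span {v}"
    using assms(1) unfolding span_eq by blast
  have "v \<noteq> 0" using a assms(3) by auto
  then have "dim {v} = 1" using dim_eq_card_independent[of "{v}"] by simp
  then show "dim I = 1" using span_eq_dim[OF eq] by simp
qed

context reflection_family
begin

text \<open>Take all translates of a finite spanning set; finiteness of \<open>G\<close> keeps the
  union finite.\<close>

lemma exists_stable_lattice:
  "\<exists>L. finite L \<and> V.span L = UNIV \<and> (\<forall>g\<in>G. g ` L = L)"
proof -
  obtain B where B: "finite B" "V.span B = UNIV" using finite_dim_V by blast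
  define L where "L = (\<Union>g\<in>G. g ` B)"
  have sub: "g ` L \<subseteq> L" if "g \<in> G" for g
  proof
    fix x assume "x \<in> g ` L"
    then obtain h b where hb: "h \<in> G" "b \<in> B" "x = g (h b)" unfolding L_def by blast
    then have "x = (g \<circ> h) b" by (metis comp_apply)
    then show "x \<in> L" unfolding L_def using G_comp[OF that hb(1)] hb(2) by blast
  qed
  have "g ` L = L" if "g \<in> G" for g
  proof
    show "L \<subseteq> g ` L"
    proof
      fix x assume "x \<in> L"
      then have "inv_into UNIV g x \<in> L" using sub[OF G_inv[OF that]] by blast
      moreover have "g (inv_into UNIV g x) = x"
        using G_bij[OF that] by (metis bij_is_surj surj_f_inv_f)
      ultimately show "x \<in> g ` L" by (metis imageI)
    qed
  qed (rule sub[OF that])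
  moreover have "finite L" unfolding L_def using finite_G B(1) by blast
  moreover have "B \<subseteq> L"
    unfolding L_def using UN_upper[OF G_id, of "\<lambda>g. g ` B"] by (simp only: image_id id_apply)
  then have "V.span L = UNIV" using V.span_mono[of B L] B(2) by blast
  ultimately show ?thesis by blast
qed

text \<open>A \<open>G\<close>-stable generating set that may be linearly dependent; the integer
  ring need not be principal, so no freeness is asked for.\<close>

definition lattice_basis :: "'v set"
  where "lattice_basis = (SOME L. finite L \<and> V.span L = UNIV \<and> (\<forall>g\<in>G. g ` L = L))"

lemma lattice_basis:
  shows finite_lattice_basis: "finite lattice_basis"
    and span_lattice_basis: "V.span lattice_basis = UNIV"
    and image_lattice_basis: "g \<in> G \<Longrightarrow> g ` lattice_basis = lattice_basis"
  using someI_ex[OF exists_stable_lattice] unfolding lattice_basis_def[symmetric] by auto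

definition lattice :: "'v set"
  where "lattice = Zk_span scaleV lattice_basis"

lemma image_lattice: "g \<in> G \<Longrightarrow> g ` lattice = lattice"
  unfolding lattice_def
  using Zk_span_image[of g scaleV scaleV lattice_basis] image_lattice_basis[of g] G_add G_scale G_0
  by metis

definition root_module :: "('v \<Rightarrow> 'v) \<Rightarrow> 'v set"
  where "root_module t = (\<lambda>x. x - t x) ` lattice"

definition root_eigenvalue :: "('v \<Rightarrow> 'v) \<Rightarrow> 'k"
  where "root_eigenvalue t = (THE z. \<exists>v w. t = reflect v w \<and> pair v w = 1 - z \<and> z \<noteq> 1)"

text \<open>Vanishing on the hyperplane of \<open>t\<close> expresses membership in the dual line
  without choosing a vector, so that equivariance can be read off from
  \<open>pair_dual\<close>.\<close>

definition coroot_module :: "('v \<Rightarrow> 'v) \<Rightarrow> 'w set"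
  where "coroot_module t = {\<beta>. (\<forall>x. t x = x \<longrightarrow> pair x \<beta> = 0) \<and>
    (\<forall>\<alpha>\<in>root_module t. \<exists>a. algebraic_int a \<and> pair \<alpha> \<beta> = (1 - root_eigenvalue t) * a)}"

definition reflection_root :: "('v \<Rightarrow> 'v) \<Rightarrow> 'v set \<times> 'w set \<times> 'k"
  where "reflection_root t = (root_module t, coroot_module t, root_eigenvalue t)"

lemma root_eigenvalue_eq:
  assumes "t = reflect v w" "pair v w = 1 - \<zeta>" "\<zeta> \<noteq> 1"
  shows "root_eigenvalue t = \<zeta>"
  unfolding root_eigenvalue_def
proof (rule the_equality)
  show "\<exists>v w. t = reflect v w \<and> pair v w = 1 - \<zeta> \<and> \<zeta> \<noteq> 1" using assms by blast
  show "z = \<zeta>" if z: "\<exists>v w. t = reflect v w \<and> pair v w = 1 - z \<and> z \<noteq> 1" for z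
  proof -
    obtain v' w' where z': "t = reflect v' w'" "pair v' w' = 1 - z" using z by blast
    have "pair v w = pair v' w'"
      by (rule reflect_pair_unique) (use assms z' in auto)
    then show ?thesis using assms z' by simp
  qed
qed

text \<open>Split \<open>x\<close> into a multiple of \<open>v\<close> and a vector fixed by
  \<open>t\<close>.\<close>

lemma pair_eq_if_vanishing:
  assumes t: "t = reflect v w" "pair v w \<noteq> 0" and \<beta>: "\<And>x. t x = x \<Longrightarrow> pair x \<beta> = 0"
  shows "pair x \<beta> = pair x w / pair v w * pair v \<beta>"
proof -
  let ?y = "x - scaleV (pair x w / pair v w) v"
  have "pair ?y w = 0" using t(2) by (simp add: pair_diff_left pair_scale_left)
  then have "t ?y = ?y" unfolding t(1) by (simp add: reflect_def)
  then have "pair ?y \<beta> = 0" by (rule \<beta>)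
  then show ?thesis by (simp add: pair_diff_left pair_scale_left)
qed

text \<open>In coordinates along \<open>v\<close> and \<open>w\<close>, the root module is the
  fractional ideal generated by \<open>A\<close>, and the coroot module is its inverse, up to
  conjugation. All claims reduce to a finite set \<open>B\<close> generating that inverse, in
  particular to 1 being in the span of the products \<open>a * b\<close>.\<close>

lemma root_structure:
  assumes t: "t \<in> T" and tr: "t = reflect v w" "pair v w = 1 - \<zeta>" "\<zeta> \<noteq> 1"
  shows "Zk_finitely_generated scaleV (root_module t)"
    and "Zk_finitely_generated scaleW (coroot_module t)"
    and "V.dim (root_module t) = 1" and "V.span (root_module t) = V.span {v}"
    and "W.dim (coroot_module t) = 1" and "W.span (coroot_module t) = W.span {w}"
    and "pair_ideal (root_module t) (coroot_module t) = {(1 - \<zeta>) * a |a. algebraic_int a}"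
proof -
  let ?I = "root_module t" and ?J = "coroot_module t" and ?M = "{(1 - \<zeta>) * a |a. algebraic_int a}"
  have z: "root_eigenvalue t = \<zeta>" by (rule root_eigenvalue_eq[OF tr])
  have nz: "pair v w \<noteq> 0" "1 - \<zeta> \<noteq> 0" using tr by simp_all
  have v: "v \<noteq> 0" using nz by auto
  have w: "w \<noteq> 0" using nz by auto
  define A where "A = (\<lambda>l. pair l w) ` lattice_basis"
  have diff: "x - t x = scaleV (pair x w) v" for x unfolding tr(1) by (simp add: reflect_def)
  have I: "?I = Zk_span scaleV ((\<lambda>a. scaleV a v) ` A)"
    unfolding root_module_def lattice_def diff A_def image_image
    by (rule Zk_span_image) (simp_all add: pair_add_left pair_scale_left V.scale_left_distrib)
  have finA: "finite A" unfolding A_def using finite_lattice_basis by blast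
  show "Zk_finitely_generated scaleV ?I"
    unfolding Zk_finitely_generated_def I using finA by blast
  have AI: "scaleV a v \<in> ?I" if "a \<in> A" for a
    unfolding I using that by (intro Zk_span_base imageI)
  have "\<exists>a\<in>A. a \<noteq> 0"
  proof (rule ccontr)
    assume neg: "\<not> ?thesis"
    have "pair x w = 0" if "x \<in> V.span lattice_basis" for x
      using that
    proof (induction rule: V.span_induct_alt)
      case (step c x y)
      then have "pair x w = 0" using neg unfolding A_def by blast
      then show ?case using step by (simp add: pair_add_left pair_scale_left)
    qed simp
    then show False using span_lattice_basis nz by blast
  qed
  then obtain a0 where a0: "a0 \<in> A" "a0 \<noteq> 0" by blast
  have Iv: "?I \<subseteq> V.span {v}"
    unfolding root_module_def diff V.span_singleton by blast
  show "V.dim ?I = 1" "V.span ?I = V.span {v}"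
    using V.dim_eq_1I[OF Iv AI[OF a0(1)]] a0(2) v by simp_all
  obtain B where B: "finite B" "\<And>a b. a \<in> A \<Longrightarrow> b \<in> B \<Longrightarrow> algebraic_int (a * b)"
    "1 \<in> Zk_span (*) {a * b |a b. a \<in> A \<and> b \<in> B}"
    using fractional_ideal_inverse[OF finA a0] by blast
  \<comment> \<open>The conjugate compensates for semilinearity on the right, so that
    \<open>b\<close> itself appears in the pairing.\<close>
  define \<beta> where "\<beta> b = scaleW (k_conj b) w" for b
  have pair_\<beta>: "pair x (\<beta> b) = pair x w * b" for x b
    by (simp add: \<beta>_def pair_scale_right mult.commute)
  have J_iff: "y \<in> ?J \<longleftrightarrow> (\<exists>c. y = \<beta> c \<and> (\<forall>\<alpha>\<in>?I. pair \<alpha> y \<in> ?M))" for y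
  proof
    assume y: "y \<in> ?J"
    have "y = \<beta> (pair v y / pair v w)"
    proof (rule pair_right_cancel)
      show "pair x y = pair x (\<beta> (pair v y / pair v w))" for x
        using pair_eq_if_vanishing[OF tr(1) nz(1), of y x] y by (simp add: coroot_module_def pair_\<beta>)
    qed
    moreover have "\<forall>\<alpha>\<in>?I. pair \<alpha> y \<in> ?M" using y by (auto simp: coroot_module_def z)
    ultimately show "\<exists>c. y = \<beta> c \<and> (\<forall>\<alpha>\<in>?I. pair \<alpha> y \<in> ?M)" by blast
  next
    assume "\<exists>c. y = \<beta> c \<and> (\<forall>\<alpha>\<in>?I. pair \<alpha> y \<in> ?M)"
    then obtain c where c: "y = \<beta> c" "\<forall>\<alpha>\<in>?I. pair \<alpha> y \<in> ?M" by blast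
    have "pair x y = 0" if "t x = x" for x
      using diff[of x] that v by (simp add: c(1) pair_\<beta>)
    then show "y \<in> ?J" using c(2) by (auto simp: coroot_module_def z)
  qed
  have BJ: "\<beta> b \<in> ?J" if "b \<in> B" for b
  proof -
    have "Zk_submodule scaleV {\<alpha>. pair \<alpha> (\<beta> b) \<in> ?M}"
      using Zk_submodule_multiples[of "1 - \<zeta>"] unfolding Zk_submodule_def
      by (simp add: pair_add_left pair_scale_left)
    moreover have "pair (scaleV a v) (\<beta> b) \<in> ?M" if "a \<in> A" for a
    proof -
      have "pair (scaleV a v) (\<beta> b) = (1 - \<zeta>) * (a * b)"
        by (simp add: pair_\<beta> pair_scale_left tr(2))
      then show ?thesis using B(2)[OF that \<open>b \<in> B\<close>] by blast
    qed
    ultimately have "?I \<subseteq> {\<alpha>. pair \<alpha> (\<beta> b) \<in> ?M}"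
      unfolding I by (intro Zk_span_minimal) auto
    then show ?thesis unfolding J_iff by blast
  qed
  have J: "?J = Zk_span scaleW (\<beta> ` B)"
  proof
    have "Zk_submodule scaleW ?J"
      unfolding Zk_submodule_def
    proof (intro conjI ballI allI impI)
      have M: "0 \<in> ?M" "\<And>x y. x \<in> ?M \<Longrightarrow> y \<in> ?M \<Longrightarrow> x + y \<in> ?M"
        "\<And>a x. algebraic_int a \<Longrightarrow> x \<in> ?M \<Longrightarrow> a * x \<in> ?M"
        using Zk_submodule_multiples[of "1 - \<zeta>"] unfolding Zk_submodule_def by blast+
      have \<beta>: "0 = \<beta> 0" "\<beta> c + \<beta> d = \<beta> (c + d)" "scaleW a (\<beta> c) = \<beta> (k_conj a * c)" for a c d
        by (simp_all add: \<beta>_def k_conj_add k_conj_mult W.scale_left_distrib)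
      show "0 \<in> ?J" unfolding J_iff using \<beta>(1) M(1) by auto
      show "x + y \<in> ?J" if xy: "x \<in> ?J" "y \<in> ?J" for x y
      proof -
        obtain c d where "x = \<beta> c" "y = \<beta> d"
          and "\<And>\<alpha>. \<alpha> \<in> ?I \<Longrightarrow> pair \<alpha> x \<in> ?M" "\<And>\<alpha>. \<alpha> \<in> ?I \<Longrightarrow> pair \<alpha> y \<in> ?M"
          using xy unfolding J_iff by blast
        then have "x + y = \<beta> (c + d)" "\<forall>\<alpha>\<in>?I. pair \<alpha> (x + y) \<in> ?M"
          unfolding pair_add_right using \<beta>(2) M(2) by blast+
        then show ?thesis unfolding J_iff by blast
      qed
      show "scaleW a x \<in> ?J" if a: "algebraic_int a" and x: "x \<in> ?J" for a x
      proof -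
        obtain c where "x = \<beta> c" and "\<And>\<alpha>. \<alpha> \<in> ?I \<Longrightarrow> pair \<alpha> x \<in> ?M"
          using x unfolding J_iff by blast
        then have "scaleW a x = \<beta> (k_conj a * c)" "\<forall>\<alpha>\<in>?I. pair \<alpha> (scaleW a x) \<in> ?M"
          unfolding pair_scale_right using \<beta>(3) M(3)[OF algebraic_int_k_conj[THEN iffD2, OF a]] by blast+
        then show ?thesis unfolding J_iff by blast
      qed
    qed
    then show "Zk_span scaleW (\<beta> ` B) \<subseteq> ?J"
      by (rule Zk_span_minimal[rotated]) (use BJ in blast)
    show "?J \<subseteq> Zk_span scaleW (\<beta> ` B)"
    proof
      fix y assume y: "y \<in> ?J"
      then obtain c where c: "y = \<beta> c" "\<forall>\<alpha>\<in>?I. pair \<alpha> y \<in> ?M" unfolding J_iff by blast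
      \<comment> \<open>Write 1 as a combination of products \<open>a * b\<close> and multiply by
        \<open>c\<close>: each \<open>a * c\<close> is integral because \<open>y\<close> is in the
        coroot module, so \<open>y\<close> becomes an integral combination of the \<beta> b.\<close>
      have "Zk_submodule (*) {x. \<beta> (x * c) \<in> Zk_span scaleW (\<beta> ` B)}"
        unfolding Zk_submodule_def
      proof (intro conjI ballI allI impI CollectI; (elim CollectE)?)
        show "\<beta> (0 * c) \<in> Zk_span scaleW (\<beta> ` B)" by (simp add: \<beta>_def Zk_span_zero)
        show "\<beta> ((x + y) * c) \<in> Zk_span scaleW (\<beta> ` B)"
          if "\<beta> (x * c) \<in> Zk_span scaleW (\<beta> ` B)" "\<beta> (y * c) \<in> Zk_span scaleW (\<beta> ` B)" for x y
          using Zk_span_add[OF that] by (simp add: \<beta>_def k_conj_add k_conj_mult distrib_right W.scale_left_distrib)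
        show "\<beta> (a * x * c) \<in> Zk_span scaleW (\<beta> ` B)"
          if "algebraic_int a" "\<beta> (x * c) \<in> Zk_span scaleW (\<beta> ` B)" for a x
          using Zk_span_scale[where a = "k_conj a", OF _ that(2)] that(1)
          by (simp add: \<beta>_def k_conj_mult mult.assoc algebraic_int_k_conj)
      qed
      moreover have "\<beta> (a * b * c) \<in> Zk_span scaleW (\<beta> ` B)" if "a \<in> A" "b \<in> B" for a b
      proof -
        obtain d where d: "algebraic_int d" "pair (scaleV a v) y = (1 - \<zeta>) * d"
          using c(2) AI[OF \<open>a \<in> A\<close>] by blast
        have "(1 - \<zeta>) * (a * c) = (1 - \<zeta>) * d"
          using d(2) by (simp add: c(1) pair_\<beta> pair_scale_left tr(2) mult_ac)
        then have "algebraic_int (a * c)" using d(1) nz(2) by simp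
        then have "scaleW (k_conj (a * c)) (\<beta> b) \<in> Zk_span scaleW (\<beta> ` B)"
          using that(2) by (intro Zk_span_scale Zk_span_base) (simp_all add: algebraic_int_k_conj)
        then show ?thesis by (simp add: \<beta>_def k_conj_mult mult_ac)
      qed
      ultimately have "Zk_span (*) {a * b |a b. a \<in> A \<and> b \<in> B} \<subseteq> {x. \<beta> (x * c) \<in> Zk_span scaleW (\<beta> ` B)}"
        by (intro Zk_span_minimal) auto
      then have "\<beta> (1 * c) \<in> Zk_span scaleW (\<beta> ` B)" using B(3) by blast
      then show "y \<in> Zk_span scaleW (\<beta> ` B)" by (simp add: c(1))
    qed
  qed
  show "Zk_finitely_generated scaleW ?J"
    unfolding Zk_finitely_generated_def J using B(1) by blast
  have "\<exists>b\<in>B. b \<noteq> 0"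
  proof (rule ccontr)
    assume "\<not> ?thesis"
    then have "Zk_span (*) {a * b |a b. a \<in> A \<and> b \<in> B} \<subseteq> {0}"
      by (intro Zk_span_minimal Zk_submodule_0) auto
    then show False using B(3) by auto
  qed
  then obtain b0 where b0: "b0 \<in> B" "b0 \<noteq> 0" by blast
  have Jw: "?J \<subseteq> W.span {w}"
    using J_iff by (auto simp: \<beta>_def W.span_base W.span_scale)
  show "W.dim ?J = 1" "W.span ?J = W.span {w}"
    using W.dim_eq_1I[OF Jw BJ[OF b0(1)]] b0(2) w by (simp_all add: \<beta>_def)
  show "pair_ideal ?I ?J = ?M"
  proof
    show "pair_ideal ?I ?J \<subseteq> ?M"
      unfolding pair_ideal_def using J_iff
      by (intro Zk_span_minimal Zk_submodule_multiples) blast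
    have gen: "pair \<alpha> \<gamma> \<in> pair_ideal ?I ?J" if "\<alpha> \<in> ?I" "\<gamma> \<in> ?J" for \<alpha> \<gamma>
      unfolding pair_ideal_def using that by (intro Zk_span_base) blast
    \<comment> \<open>The same expression of 1, multiplied by 1 - \<zeta>, puts this generator into
      the ideal, since each (1 - \<zeta>) a b is a pairing of generators.\<close>
    have "Zk_submodule (*) {x. (1 - \<zeta>) * x \<in> pair_ideal ?I ?J}"
      using Zk_submodule_Zk_span[of "(*)" "{pair \<alpha> \<beta> |\<alpha> \<beta>. \<alpha> \<in> ?I \<and> \<beta> \<in> ?J}"]
      unfolding pair_ideal_def[symmetric] Zk_submodule_def
      by (simp add: distrib_left mult.left_commute)
    moreover have "(1 - \<zeta>) * (a * b) \<in> pair_ideal ?I ?J" if "a \<in> A" "b \<in> B" for a b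
      using gen[OF AI[OF that(1)] BJ[OF that(2)]] by (simp add: pair_\<beta> pair_scale_left tr(2) mult_ac)
    ultimately have "Zk_span (*) {a * b |a b. a \<in> A \<and> b \<in> B} \<subseteq> {x. (1 - \<zeta>) * x \<in> pair_ideal ?I ?J}"
      by (intro Zk_span_minimal) auto
    then have "1 - \<zeta> \<in> pair_ideal ?I ?J" using B(3) by auto
    then show "?M \<subseteq> pair_ideal ?I ?J"
      unfolding pair_ideal_def by (auto simp: mult.commute[of "1 - \<zeta>"] intro: Zk_span_scale)
  qed
qed

section \<open>The axioms of a root system for the constructed roots\<close>

lemma T_reflectE:
  assumes "t \<in> T"
  obtains v w \<zeta> n where "t = reflect v w" "pair v w = 1 - \<zeta>" "\<zeta> \<noteq> 1" "\<zeta> ^ n = 1" "n > 0"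
  using is_reflection_imp_reflect[OF reflection_T[OF assms]] .

lemma is_root_root:
  assumes "t \<in> T"
  shows "is_root (reflection_root t)"
proof -
  obtain v w \<zeta> n where tr: "t = reflect v w" "pair v w = 1 - \<zeta>" "\<zeta> \<noteq> 1" "\<zeta> ^ n = 1" "n > 0"
    using T_reflectE[OF assms] .
  show ?thesis
    using root_structure[OF assms tr(1-3)] tr(3-5)
    unfolding reflection_root_def is_root_def root_eigenvalue_eq[OF tr(1-3)] by auto
qed

lemma root_reflection_root:
  assumes "t \<in> T"
  shows "root_reflection (reflection_root t) = t"
proof -
  obtain v w \<zeta> n where tr: "t = reflect v w" "pair v w = 1 - \<zeta>" "\<zeta> \<noteq> 1"
    using T_reflectE[OF assms] by metis
  have "root_reflection (reflection_root t) = reflect v w"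
    unfolding reflection_root_def
  proof (rule root_reflection_eq)
    show "is_root (root_module t, coroot_module t, root_eigenvalue t)"
      using is_root_root[OF assms] unfolding reflection_root_def .
    show "v \<in> V.span (root_module t)" "w \<in> W.span (coroot_module t)"
      unfolding root_structure(4,6)[OF assms tr] by (simp_all add: V.span_base W.span_base)
    show "pair v w = 1 - root_eigenvalue t" using tr root_eigenvalue_eq[OF tr] by simp
  qed
  then show ?thesis unfolding tr(1)[symmetric] .
qed

lemma pair_root_coroot_integral:
  assumes "s \<in> T" "t \<in> T"
  shows "pair_ideal (root_module s) (coroot_module t) \<subseteq> {a. algebraic_int a}"
  unfolding pair_ideal_def
proof (rule Zk_span_minimal)
  show "Zk_submodule (*) {a::'k. algebraic_int a}"
    unfolding Zk_submodule_def by (auto intro: algebraic_int_add algebraic_int_mult)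
  obtain v w \<zeta> n where tr: "t = reflect v w" "pair v w = 1 - \<zeta>" "\<zeta> \<noteq> 1"
    using T_reflectE[OF assms(2)] by metis
  have "algebraic_int (pair \<alpha> \<beta>)" if \<alpha>: "\<alpha> \<in> root_module s" and \<beta>: "\<beta> \<in> coroot_module t" for \<alpha> \<beta>
  proof -
    obtain x where x: "x \<in> lattice" "\<alpha> = x - s x" using \<alpha> unfolding root_module_def by blast
    \<comment> \<open>Stability of the lattice under \<open>s\<close> places the root module of
      \<open>s\<close> inside it, so \<open>1 - t\<close> can be applied to \<alpha>.\<close>
    have "s x \<in> lattice" using x(1) image_lattice[OF generate.incl[OF assms(1)]] by blast
    then have "scaleV (- 1) (s x) \<in> lattice" unfolding lattice_def by (intro Zk_span_scale) auto
    then have "\<alpha> \<in> lattice" using x unfolding lattice_def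
      by (metis Zk_span_add V.scale_minus_left V.scale_one diff_conv_add_uminus)
    then have "\<alpha> - t \<alpha> \<in> root_module t" unfolding root_module_def by blast
    then obtain a where a: "algebraic_int a" "pair (\<alpha> - t \<alpha>) \<beta> = (1 - \<zeta>) * a"
      using \<beta> unfolding coroot_module_def root_eigenvalue_eq[OF tr] by blast
    have "\<alpha> - t \<alpha> = scaleV (pair \<alpha> w) v" unfolding tr(1) by (simp add: reflect_def)
    then have "pair \<alpha> w * pair v \<beta> = (1 - \<zeta>) * a" using a(2) by (simp add: pair_scale_left)
    moreover have "pair \<alpha> \<beta> = pair \<alpha> w / pair v w * pair v \<beta>"
      by (rule pair_eq_if_vanishing[OF tr(1)]) (use tr \<beta> in \<open>auto simp: coroot_module_def\<close>)
    ultimately have "pair \<alpha> \<beta> = a" using tr(2,3) by simp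
    then show ?thesis using a(1) by simp
  qed
  then show "{pair \<alpha> \<beta> |\<alpha> \<beta>. \<alpha> \<in> root_module s \<and> \<beta> \<in> coroot_module t} \<subseteq> {a. algebraic_int a}" by blast
qed

text \<open>Equivariance of the construction: the lattice is \<open>G\<close>-stable,
  \<open>dual g\<close> preserves pairings, and conjugation preserves the eigenvalue. Stability of
  the root system under its reflections follows, because \<open>T\<close> is closed under
  conjugation.\<close>

lemma root_action_root:
  assumes g: "g \<in> G" and t: "t \<in> T"
  shows "root_action g (reflection_root t) = reflection_root (conj_by g t)"
proof -
  let ?u = "conj_by g t"
  have gc: "g \<in> carrier (GL scaleV)" using G_linear[OF g] G_bij[OF g] by simp
  interpret g: Vector_Spaces.linear scaleV scaleV g by (rule G_linear[OF g])
  have comm: "?u (g x) = g (t x)" for x using fun_cong[OF G_conj_by_commute[OF g, of t], of x] by simp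
  have I: "g ` root_module t = root_module ?u"
  proof -
    have "root_module ?u = (\<lambda>x. x - ?u x) ` g ` lattice"
      unfolding root_module_def image_lattice[OF g] ..
    also have "\<dots> = g ` root_module t"
      unfolding root_module_def image_image comm g.diff ..
    finally show ?thesis ..
  qed
  obtain v w \<zeta> n where tr: "t = reflect v w" "pair v w = 1 - \<zeta>" "\<zeta> \<noteq> 1"
    using T_reflectE[OF t] by metis
  have "?u = reflect (g v) (dual g w)"
    using conj_by_eqI[OF G_bij[OF g] reflect_conjugate[OF gc, of v w]] unfolding tr(1)[symmetric] .
  then have z: "root_eigenvalue ?u = root_eigenvalue t"
    using root_eigenvalue_eq[OF tr] root_eigenvalue_eq[OF _ _ tr(3), of ?u "g v" "dual g w"] tr(2)
    by (simp only: pair_dual[OF gc])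
  have all_g: "(\<forall>y. P y) \<longleftrightarrow> (\<forall>x. P (g x))" for P
    using bij_is_surj[OF G_bij[OF g]] by (metis surjD)
  have J_iff: "dual g \<beta> \<in> coroot_module ?u \<longleftrightarrow> \<beta> \<in> coroot_module t" for \<beta>
  proof -
    have "g x = g y \<longleftrightarrow> x = y" for x y using G_bij[OF g] by (simp add: bij_is_inj inj_eq)
    then have "(\<forall>x. ?u x = x \<longrightarrow> pair x (dual g \<beta>) = 0) \<longleftrightarrow> (\<forall>x. t x = x \<longrightarrow> pair x \<beta> = 0)"
      unfolding all_g[of "\<lambda>x. ?u x = x \<longrightarrow> pair x (dual g \<beta>) = 0"]
      by (simp only: comm pair_dual[OF gc])
    moreover have "(\<forall>\<alpha>\<in>root_module ?u. \<exists>a. algebraic_int a \<and> pair \<alpha> (dual g \<beta>) = (1 - root_eigenvalue t) * a)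
        \<longleftrightarrow> (\<forall>\<alpha>\<in>root_module t. \<exists>a. algebraic_int a \<and> pair \<alpha> \<beta> = (1 - root_eigenvalue t) * a)"
      unfolding I[symmetric] by (simp only: ball_simps pair_dual[OF gc])
    ultimately show ?thesis unfolding coroot_module_def z by (simp only: mem_Collect_eq)
  qed
  have "dual g ` coroot_module t = coroot_module ?u"
  proof
    show "dual g ` coroot_module t \<subseteq> coroot_module ?u" using J_iff by blast
    show "coroot_module ?u \<subseteq> dual g ` coroot_module t"
    proof
      fix \<beta> assume \<beta>: "\<beta> \<in> coroot_module ?u"
      obtain \<gamma> where "\<beta> = dual g \<gamma>" using dual_in_GL[OF gc] by (metis GL_simps(1) bij_pointE)
      then show "\<beta> \<in> dual g ` coroot_module t" using J_iff \<beta> by blast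
    qed
  qed
  then show ?thesis unfolding reflection_root_def root_action_def using I z by simp
qed

theorem root_system_root: "root_system (reflection_root ` T)"
  unfolding root_system_def
proof (intro conjI ballI)
  show "is_root r" if "r \<in> reflection_root ` T" for r using that is_root_root by blast
  show "finite (reflection_root ` T)" using finite_T by blast
  have "range (\<lambda>x. x - t x) \<subseteq> V.span (\<Union>(I, J, \<zeta>)\<in>reflection_root ` T. I)" if t: "t \<in> T" for t
  proof -
    obtain v w \<zeta> n where tr: "t = reflect v w" "pair v w = 1 - \<zeta>" "\<zeta> \<noteq> 1"
      using T_reflectE[OF t] by metis
    have "root_module t \<subseteq> (\<Union>(I, J, \<zeta>)\<in>reflection_root ` T. I)"
      using UN_upper[OF imageI[OF t], of "\<lambda>(I, J, \<zeta>). I" reflection_root] unfolding reflection_root_def prod.case .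
    from V.span_mono[OF this] have "V.span {v} \<subseteq> V.span (\<Union>(I, J, \<zeta>)\<in>reflection_root ` T. I)"
      unfolding root_structure(4)[OF t tr] .
    moreover have "x - t x = scaleV (pair x w) v" for x unfolding tr(1) by (simp add: reflect_def)
    then have "range (\<lambda>x. x - t x) \<subseteq> V.span {v}" unfolding V.span_singleton by blast
    ultimately show ?thesis by blast
  qed
  then have "(\<Union>t\<in>T. range (\<lambda>x. x - t x)) \<subseteq> V.span (\<Union>(I, J, \<zeta>)\<in>reflection_root ` T. I)" by (rule UN_least)
  from V.span_minimal[OF this V.subspace_span] show "V.span (\<Union>(I, J, \<zeta>)\<in>reflection_root ` T. I) = UNIV"
    unfolding span_T by blast
  show "root_action (root_reflection r) ` reflection_root ` T = reflection_root ` T" if "r \<in> reflection_root ` T" for r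
  proof -
    obtain s where s: "s \<in> T" "r = reflection_root s" using \<open>r \<in> reflection_root ` T\<close> by blast
    have sG: "s \<in> G" using s(1) by (rule generate.incl)
    have "conj_by s ` T = T"
    proof
      show "conj_by s ` T \<subseteq> T" using conj_by_T[OF sG] by blast
      show "T \<subseteq> conj_by s ` T"
      proof
        fix u assume "u \<in> T"
        then have "conj_by (inv_into UNIV s) u \<in> T" by (rule conj_by_T[OF G_inv[OF sG]])
        then show "u \<in> conj_by s ` T" using conj_by_inv'[OF sG, of u] by (intro image_eqI) simp_all
      qed
    qed
    moreover have "root_action s ` reflection_root ` T = reflection_root ` conj_by s ` T"
      unfolding image_image by (rule image_cong[OF refl root_action_root[OF sG]])
    ultimately show ?thesis unfolding s(2) root_reflection_root[OF s(1)] by simp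
  qed
  show "case p of (I\<^sub>1, J\<^sub>1, \<zeta>\<^sub>1) \<Rightarrow> \<forall>(I\<^sub>2, J\<^sub>2, \<zeta>\<^sub>2)\<in>reflection_root ` T. pair_ideal I\<^sub>1 J\<^sub>2 \<subseteq> {a. algebraic_int a}"
    if "p \<in> reflection_root ` T" for p
  proof -
    obtain s where s: "s \<in> T" "p = reflection_root s" using \<open>p \<in> reflection_root ` T\<close> by blast
    have "case q of (I\<^sub>2, J\<^sub>2, \<zeta>\<^sub>2) \<Rightarrow> pair_ideal (root_module s) J\<^sub>2 \<subseteq> {a. algebraic_int a}"
      if q: "q \<in> reflection_root ` T" for q
    proof -
      obtain t where t: "t \<in> T" "q = reflection_root t" using q by blast
      show ?thesis unfolding t(2) reflection_root_def prod.case by (rule pair_root_coroot_integral[OF s(1) t(1)])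
    qed
    then show ?thesis unfolding s(2) reflection_root_def prod.case by blast
  qed
qed

lemma root_group_root: "root_group (reflection_root ` T) = G"
proof -
  have "root_reflection ` reflection_root ` T = T"
    unfolding image_image using root_reflection_root by simp
  then show ?thesis unfolding root_group_def by simp
qed

end

theorem theorem3p16:
  fixes emb :: "'k::field_char_0 \<Rightarrow> complex"
    and scaleV :: "'k \<Rightarrow> 'v::ab_group_add \<Rightarrow> 'v"
    and scaleW :: "'k \<Rightarrow> 'w::ab_group_add \<Rightarrow> 'w"
    and pair :: "'v \<Rightarrow> 'w \<Rightarrow> 'k"
  assumes "hermitian_pairing emb scaleV scaleW pair"
  shows "(\<forall>R. hermitian_pairing.root_system scaleV scaleW pair R \<longrightarrow>
            essential_finite_reflection_group scaleV
              (hermitian_pairing.root_group scaleV scaleW pair R)) \<and>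
         (\<forall>G. essential_finite_reflection_group scaleV G \<longrightarrow>
            (\<exists>R. hermitian_pairing.root_system scaleV scaleW pair R \<and>
                 hermitian_pairing.root_group scaleV scaleW pair R = G))"
proof -
  interpret hermitian_pairing emb scaleV scaleW pair by fact
  have "essential_finite_reflection_group scaleV (root_group R)" if "root_system R" for R
  proof -
    interpret reflection_family emb scaleV scaleW pair "root_reflection ` R"
      by (rule root_system_reflection_family[OF that])
    show ?thesis unfolding root_group_def by (rule essential_finite_reflection_group_G)
  qed
  moreover have "\<exists>R. root_system R \<and> root_group R = G"
    if G: "essential_finite_reflection_group scaleV G" for G
  proof -
    interpret F: reflection_family emb scaleV scaleW pair "{s \<in> G. is_reflection scaleV s}"
      by (rule reflection_group_reflection_family(1)[OF G])
    show ?thesis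
      using F.root_system_root F.root_group_root unfolding reflection_group_reflection_family(2)[OF G] by blast
  qed
  ultimately show ?thesis by blast
qed

end
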